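(* Let $k\ge 1$ and let $(\Lambda, d)$ be a discrete finitely aligned $k$-graph with no sources. Then the following are equivalent. (i) For each $v \in \Lambda^0$ there exists an aperiodic path $x \in v\partial\Lambda$. (ii) For each $v \in \Lambda^0$ and each $m \neq n \in \mathbb{N}^k$ there exists a path $\lambda \in v\Lambda$ such that $d(\lambda) \geq m \vee n$ and $$\lambda(m,\, m + d(\lambda) - (m \vee n)) \neq \lambda(n,\, n + d(\lambda) - (m \vee n)).$$ (iii) For every pair of distinct paths $\alpha, \beta \in \Lambda$ with $s(\alpha) = s(\beta)$ there exists a path $\tau \in s(\alpha)\Lambda$ such that $\operatorname{MCE}(\alpha\tau, \beta\tau) = \emptyset$.
   Context: $\mathbb{N}$ contains $0$; $\mathbb{N}^k$ is regarded as a category with one object and composition given by addition. For $m,n\in\mathbb{N}^k$, $m \ge n$ means $m_i\ge n_i$ for all $i$; $m\vee n$ denotes the coordinatewise maximum. A discrete $k$-graph is a pair $(\Lambda,d)$ consisting of a countable small category $\Lambda$ with range and source maps $r,s$ and a functor $d:\Lambda\to\mathbb{N}^k$ with the unique factorization property: for all $\lambda\in\Lambda$ and $m,n\in\mathbb{N}^k$ with $d(\lambda)=m+n$ there exist unique $\mu,\nu\in\Lambda$ with $d(\mu)=m$, $d(\nu)=n$ and $\lambda=\mu\nu$. (Equivalently, it is a topological $k$-graph whose object and morphism spaces are discrete.) Elements of $\Lambda$ (morphisms) are called paths. $\Lambda^n := d^{-1}(n)$; $\Lambda^0$ is the set of identity morphisms, called vertices and identified with the objects. For $v\in\Lambda^0$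 and $S\subset\Lambda$, $vS=\{\lambda\in S : r(\lambda)=v\}$; for $V\subset\Lambda^0$, $V\Lambda=\{\lambda: r(\lambda)\in V\}$. A vertex $v$ is a source if $v\Lambda^n=\emptyset$ for some $n\in\mathbb{N}^k$; $\Lambda$ has no sources if no vertex is a source. For $p\le q\le d(\lambda)$, $\lambda(p,q)$ denotes the unique element of $\Lambda^{q-p}$ such that $\lambda=\lambda'\,\lambda(p,q)\,\lambda''$ with $d(\lambda')=p$ and $d(\lambda'')=d(\lambda)-q$. For $\mu,\nu\in\Lambda$, $\operatorname{MCE}(\mu,\nu)$ is the set of minimal common extensions: those $\lambda\in\Lambda$ with $\lambda=\mu\mu'=\nu\nu'$ for some $\mu',\nu'\in\Lambda$ and $d(\lambda)=d(\mu)\vee d(\nu)$. $\Lambda$ is finitely aligned if $\operatorname{MCE}(\mu,\nu)$ is finite (possibly empty) for all $\mu,\nu\in\Lambda$. For $m\in(\mathbb{N}\cup\{\infty\})^k$, $\Omega_{k,m}$ is the discrete $k$-graph with morphisms $\{(p,q)\in\mathbb{N}^k\times\mathbb{N}^k : p\le q\le m\}$, $r(p,q)=(p,p)$, $s(p,q)=(q,q)$, $(p,q)(q,t)=(p,t)$ and degree $q-p$. The path space $X_\Lambda$ is the set of all degree-preserving functors $x:\Omega_{k,m}\to\Lambda$, $m\in(\mathbb{N}\cup\{\infty\})^k$; for such $x$ set $d(x)=m$ and $r(x)=x(0,0)$. For $m\in\mathbb{N}^k$ with $m\le d(x)$, the shift $\sigma^m x\in X_\Lambda$ is the unique path with $d(\sigma^m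 x)=d(x)-m$ and $\sigma^m x(0,n)=x(m,m+n)$ for all $0\le n\le d(x)-m$. A path $x\in X_\Lambda$ is aperiodic if for any $m,n\in\mathbb{N}^k$ (for which the shifts are defined), $\sigma^m x=\sigma^n x$ implies $m=n$. For $v\in\Lambda^0$, a subset $E\subset\Lambda$ is compact exhaustive for $v$ if $E$ is compact (here: finite), $r(E)$ is a neighborhood of $v$ (here: $v\in r(E)$), and for all $\lambda\in r(E)\Lambda$ there is $\mu\in E$ with $\operatorname{MCE}(\lambda,\mu)\ne\emptyset$. A path $x\in X_\Lambda$ is a boundary path if for every $m\in\mathbb{N}^k$ with $m\le d(x)$ and every $E$ that is compact exhaustive for $x(m,m)$, there exists $\lambda\in E$ such that $x(m,m+d(\lambda))=\lambda$ (in particular $m+d(\lambda)\le d(x)$). $\partial\Lambda$ is the set of boundary paths, and $v\partial\Lambda=\{x\in\partial\Lambda : r(x)=v\}$. *)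

theory Defs
  imports
    "HOL-Library.Function_Algebras"
    "HOL-Library.Extended_Nat"
    "HOL-Library.FuncSet"
    "HOL-Library.Countable_Set"
begin

text \<open>
  Degrees in \<open>\<nat>\<^sup>k\<close> are functions \<^typ>\<open>'k \<Rightarrow> nat\<close> with \<^typ>\<open>'k\<close> of class \<^class>\<open>finite\<close>
  (so \<open>k = CARD('k) \<ge> 1\<close>); order, \<^term>\<open>sup\<close>, addition and subtraction are pointwise.
  Degrees in \<open>(\<nat> \<union> {\<infinity>})\<^sup>k\<close> are functions \<^typ>\<open>'k \<Rightarrow> enat\<close>.

  Categories are one-sorted: an object is identified with its identity morphism, so range and
  source are maps from morphisms to morphisms. Composition \<open>\<mu>\<nu>\<close> is meaningful when
  \<open>s(\<mu>) = r(\<nu>)\<close>.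
\<close>

record ('a, 'k) graded_category =
  Mor :: "'a set"
  rng :: "'a \<Rightarrow> 'a"
  src :: "'a \<Rightarrow> 'a"
  cmp :: "'a \<Rightarrow> 'a \<Rightarrow> 'a" (infixl "\<cdot>\<index>" 70)
  deg :: "'a \<Rightarrow> 'k \<Rightarrow> nat"

locale small_category =
  fixes \<Lambda> :: "('a, 'k) graded_category" (structure)
  assumes rng_closed: "\<kappa> \<in> Mor \<Lambda> \<Longrightarrow> rng \<Lambda> \<kappa> \<in> Mor \<Lambda>"
    and src_closed: "\<kappa> \<in> Mor \<Lambda> \<Longrightarrow> src \<Lambda> \<kappa> \<in> Mor \<Lambda>"
    and rng_rng: "\<kappa> \<in> Mor \<Lambda> \<Longrightarrow> rng \<Lambda> (rng \<Lambda> \<kappa>) = rng \<Lambda> \<kappa>"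
    and src_rng: "\<kappa> \<in> Mor \<Lambda> \<Longrightarrow> src \<Lambda> (rng \<Lambda> \<kappa>) = rng \<Lambda> \<kappa>"
    and rng_src: "\<kappa> \<in> Mor \<Lambda> \<Longrightarrow> rng \<Lambda> (src \<Lambda> \<kappa>) = src \<Lambda> \<kappa>"
    and src_src: "\<kappa> \<in> Mor \<Lambda> \<Longrightarrow> src \<Lambda> (src \<Lambda> \<kappa>) = src \<Lambda> \<kappa>"
    and cmp_closed: "\<lbrakk>\<mu> \<in> Mor \<Lambda>; \<nu> \<in> Mor \<Lambda>; src \<Lambda> \<mu> = rng \<Lambda> \<nu>\<rbrakk> \<Longrightarrow> \<mu> \<cdot> \<nu> \<in> Mor \<Lambda>"
    and rng_cmp: "\<lbrakk>\<mu> \<in> Mor \<Lambda>; \<nu> \<in> Mor \<Lambda>; src \<Lambda> \<mu> = rng \<Lambda> \<nu>\<rbrakk> \<Longrightarrow> rng \<Lambda> (\<mu> \<cdot> \<nu>) = rng \<Lambda> \<mu>"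
    and src_cmp: "\<lbrakk>\<mu> \<in> Mor \<Lambda>; \<nu> \<in> Mor \<Lambda>; src \<Lambda> \<mu> = rng \<Lambda> \<nu>\<rbrakk> \<Longrightarrow> src \<Lambda> (\<mu> \<cdot> \<nu>) = src \<Lambda> \<nu>"
    and cmp_assoc: "\<lbrakk>\<kappa> \<in> Mor \<Lambda>; \<mu> \<in> Mor \<Lambda>; \<nu> \<in> Mor \<Lambda>; src \<Lambda> \<kappa> = rng \<Lambda> \<mu>; src \<Lambda> \<mu> = rng \<Lambda> \<nu>\<rbrakk>
      \<Longrightarrow> (\<kappa> \<cdot> \<mu>) \<cdot> \<nu> = \<kappa> \<cdot> (\<mu> \<cdot> \<nu>)"
    and rng_id: "\<kappa> \<in> Mor \<Lambda> \<Longrightarrow> rng \<Lambda> \<kappa> \<cdot> \<kappa> = \<kappa>"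
    and src_id: "\<kappa> \<in> Mor \<Lambda> \<Longrightarrow> \<kappa> \<cdot> src \<Lambda> \<kappa> = \<kappa>"

locale discrete_k_graph = small_category \<Lambda>
  for \<Lambda> :: "('a, 'k::finite) graded_category" (structure) +
  assumes countable_Mor: "countable (Mor \<Lambda>)"
    and deg_id: "\<kappa> \<in> Mor \<Lambda> \<Longrightarrow> deg \<Lambda> (rng \<Lambda> \<kappa>) = 0"
    and deg_cmp: "\<lbrakk>\<mu> \<in> Mor \<Lambda>; \<nu> \<in> Mor \<Lambda>; src \<Lambda> \<mu> = rng \<Lambda> \<nu>\<rbrakk>
      \<Longrightarrow> deg \<Lambda> (\<mu> \<cdot> \<nu>) = deg \<Lambda> \<mu> + deg \<Lambda> \<nu>"
    and unique_factorization: "\<lbrakk>\<kappa> \<in> Mor \<Lambda>; deg \<Lambda> \<kappa> = m + n\<rbrakk>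
      \<Longrightarrow> \<exists>!(\<mu>, \<nu>). \<mu> \<in> Mor \<Lambda> \<and> \<nu> \<in> Mor \<Lambda> \<and> src \<Lambda> \<mu> = rng \<Lambda> \<nu> \<and>
                deg \<Lambda> \<mu> = m \<and> deg \<Lambda> \<nu> = n \<and> \<kappa> = \<mu> \<cdot> \<nu>"

definition paths_of_degree :: "('a, 'k) graded_category \<Rightarrow> ('k \<Rightarrow> nat) \<Rightarrow> 'a set" where
  "paths_of_degree \<Lambda> n = {\<kappa> \<in> Mor \<Lambda>. deg \<Lambda> \<kappa> = n}"

abbreviation vertices :: "('a, 'k) graded_category \<Rightarrow> 'a set" where
  "vertices \<Lambda> \<equiv> paths_of_degree \<Lambda> 0"

definition with_range :: "('a, 'k) graded_category \<Rightarrow> 'a set \<Rightarrow> 'a set \<Rightarrow> 'a set" where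
  "with_range \<Lambda> V S = {\<kappa> \<in> S. rng \<Lambda> \<kappa> \<in> V}"

definition is_source :: "('a, 'k) graded_category \<Rightarrow> 'a \<Rightarrow> bool" where
  "is_source \<Lambda> v \<longleftrightarrow> (\<exists>n. with_range \<Lambda> {v} (paths_of_degree \<Lambda> n) = {})"

definition no_sources :: "('a, 'k) graded_category \<Rightarrow> bool" where
  "no_sources \<Lambda> \<longleftrightarrow> (\<forall>v \<in> vertices \<Lambda>. \<not> is_source \<Lambda> v)"

definition is_segment ::
    "('a, 'k) graded_category \<Rightarrow> 'a \<Rightarrow> ('k \<Rightarrow> nat) \<Rightarrow> ('k \<Rightarrow> nat) \<Rightarrow> 'a \<Rightarrow> bool" where
  "is_segment \<Lambda> \<kappa> p q \<xi> \<longleftrightarrow> \<xi> \<in> paths_of_degree \<Lambda> (q - p) \<and>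
     (\<exists>\<kappa>' \<in> paths_of_degree \<Lambda> p. \<exists>\<kappa>'' \<in> paths_of_degree \<Lambda> (deg \<Lambda> \<kappa> - q).
        src \<Lambda> \<kappa>' = rng \<Lambda> \<xi> \<and> src \<Lambda> \<xi> = rng \<Lambda> \<kappa>'' \<and> \<kappa> = \<kappa>' \<cdot>\<^bsub>\<Lambda>\<^esub> \<xi> \<cdot>\<^bsub>\<Lambda>\<^esub> \<kappa>'')"

text \<open>\<open>\<kappa>(p, q)\<close>, meaningful only for \<open>p \<le> q \<le> d(\<kappa>)\<close>.\<close>
definition segment ::
    "('a, 'k) graded_category \<Rightarrow> 'a \<Rightarrow> ('k \<Rightarrow> nat) \<Rightarrow> ('k \<Rightarrow> nat) \<Rightarrow> 'a" where
  "segment \<Lambda> \<kappa> p q = (THE \<xi>. is_segment \<Lambda> \<kappa> p q \<xi>)"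

definition MCE :: "('a, 'k) graded_category \<Rightarrow> 'a \<Rightarrow> 'a \<Rightarrow> 'a set" where
  "MCE \<Lambda> \<mu> \<nu> = {\<kappa> \<in> Mor \<Lambda>.
     (\<exists>\<mu>' \<in> Mor \<Lambda>. src \<Lambda> \<mu> = rng \<Lambda> \<mu>' \<and> \<kappa> = \<mu> \<cdot>\<^bsub>\<Lambda>\<^esub> \<mu>') \<and>
     (\<exists>\<nu>' \<in> Mor \<Lambda>. src \<Lambda> \<nu> = rng \<Lambda> \<nu>' \<and> \<kappa> = \<nu> \<cdot>\<^bsub>\<Lambda>\<^esub> \<nu>') \<and>
     deg \<Lambda> \<kappa> = sup (deg \<Lambda> \<mu>) (deg \<Lambda> \<nu>)}"

definition finitely_aligned :: "('a, 'k) graded_category \<Rightarrow> bool" where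
  "finitely_aligned \<Lambda> \<longleftrightarrow> (\<forall>\<mu> \<in> Mor \<Lambda>. \<forall>\<nu> \<in> Mor \<Lambda>. finite (MCE \<Lambda> \<mu> \<nu>))"

definition Omega :: "('k \<Rightarrow> enat) \<Rightarrow> (('k \<Rightarrow> nat) \<times> ('k \<Rightarrow> nat), 'k) graded_category" where
  "Omega m = \<lparr>Mor = {(p, q). p \<le> q \<and> enat \<circ> q \<le> m},
     rng = (\<lambda>(p, q). (p, p)),
     src = (\<lambda>(p, q). (q, q)),
     cmp = (\<lambda>(p, q) (q', t). (p, t)),
     deg = (\<lambda>(p, q). q - p)\<rparr>"

definition degree_functor ::
    "('a, 'k) graded_category \<Rightarrow> ('b, 'k) graded_category \<Rightarrow> ('a \<Rightarrow> 'b) \<Rightarrow> bool" where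
  "degree_functor C D F \<longleftrightarrow>
     (\<forall>a \<in> Mor C. F a \<in> Mor D \<and> F (rng C a) = rng D (F a) \<and> F (src C a) = src D (F a) \<and>
                  deg D (F a) = deg C a) \<and>
     (\<forall>a \<in> Mor C. \<forall>b \<in> Mor C. src C a = rng C b \<longrightarrow> F (a \<cdot>\<^bsub>C\<^esub> b) = F a \<cdot>\<^bsub>D\<^esub> F b)"

text \<open>
  A path \<open>x\<close> is the pair of its degree \<open>m\<close> and its underlying function, which is required to be
  \<^const>\<open>undefined\<close> outside the morphisms of \<open>\<Omega>\<^bsub>k,m\<^esub>\<close>, so that equality of paths is equality of
  pairs.
\<close>
type_synonym ('a, 'k) gpath = "('k \<Rightarrow> enat) \<times> (('k \<Rightarrow> nat) \<times> ('k \<Rightarrow> nat) \<Rightarrow> 'a)"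

definition path_space :: "('a, 'k) graded_category \<Rightarrow> ('a, 'k) gpath set" where
  "path_space \<Lambda> = {(m, f). f \<in> extensional (Mor (Omega m)) \<and> degree_functor (Omega m) \<Lambda> f}"

definition pdeg :: "('a, 'k) gpath \<Rightarrow> 'k \<Rightarrow> enat" where
  "pdeg x = fst x"

definition pseg :: "('a, 'k) gpath \<Rightarrow> ('k \<Rightarrow> nat) \<Rightarrow> ('k \<Rightarrow> nat) \<Rightarrow> 'a" where
  "pseg x p q = snd x (p, q)"

definition prng :: "('a, 'k) gpath \<Rightarrow> 'a" where
  "prng x = pseg x 0 0"

text \<open>\<open>\<sigma>\<^sup>m x\<close>, meaningful only for \<open>m \<le> d(x)\<close>.\<close>
definition shift ::
    "('a, 'k) graded_category \<Rightarrow> ('k \<Rightarrow> nat) \<Rightarrow> ('a, 'k) gpath \<Rightarrow> ('a, 'k) gpath" where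
  "shift \<Lambda> m x = (THE y. y \<in> path_space \<Lambda> \<and> pdeg y = pdeg x - (enat \<circ> m) \<and>
     (\<forall>n. enat \<circ> n \<le> pdeg x - (enat \<circ> m) \<longrightarrow> pseg y 0 n = pseg x m (m + n)))"

definition aperiodic :: "('a, 'k) graded_category \<Rightarrow> ('a, 'k) gpath \<Rightarrow> bool" where
  "aperiodic \<Lambda> x \<longleftrightarrow> (\<forall>m n. enat \<circ> m \<le> pdeg x \<longrightarrow> enat \<circ> n \<le> pdeg x \<longrightarrow>
     shift \<Lambda> m x = shift \<Lambda> n x \<longrightarrow> m = n)"

text \<open>In the discrete topology compact means finite, and a neighbourhood of \<open>v\<close> is a set containing \<open>v\<close>.\<close>
definition compact_exhaustive :: "('a, 'k) graded_category \<Rightarrow> 'a \<Rightarrow> 'a set \<Rightarrow> bool" where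
  "compact_exhaustive \<Lambda> v E \<longleftrightarrow> E \<subseteq> Mor \<Lambda> \<and> finite E \<and> v \<in> rng \<Lambda> ` E \<and>
     (\<forall>\<kappa> \<in> with_range \<Lambda> (rng \<Lambda> ` E) (Mor \<Lambda>). \<exists>\<mu> \<in> E. MCE \<Lambda> \<kappa> \<mu> \<noteq> {})"

definition boundary_paths :: "('a, 'k) graded_category \<Rightarrow> ('a, 'k) gpath set" where
  "boundary_paths \<Lambda> = {x \<in> path_space \<Lambda>.
     \<forall>m E. enat \<circ> m \<le> pdeg x \<longrightarrow> compact_exhaustive \<Lambda> (pseg x m m) E \<longrightarrow>
       (\<exists>\<kappa> \<in> E. enat \<circ> (m + deg \<Lambda> \<kappa>) \<le> pdeg x \<and> pseg x m (m + deg \<Lambda> \<kappa>) = \<kappa>)}"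

definition boundary_paths_at :: "('a, 'k) graded_category \<Rightarrow> 'a \<Rightarrow> ('a, 'k) gpath set" where
  "boundary_paths_at \<Lambda> v = {x \<in> boundary_paths \<Lambda>. prng x = v}"

lemma (in discrete_k_graph) factorization_unique:
  assumes "\<mu> \<in> Mor \<Lambda>" "\<nu> \<in> Mor \<Lambda>" "src \<Lambda> \<mu> = rng \<Lambda> \<nu>"
    and "\<mu>' \<in> Mor \<Lambda>" "\<nu>' \<in> Mor \<Lambda>" "src \<Lambda> \<mu>' = rng \<Lambda> \<nu>'"
    and "\<mu> \<cdot> \<nu> = \<mu>' \<cdot> \<nu>'" "deg \<Lambda> \<mu> = deg \<Lambda> \<mu>'"
  shows "\<mu> = \<mu>' \<and> \<nu> = \<nu>'"
proof -
  have 1: "deg \<Lambda> (\<mu> \<cdot> \<nu>) = deg \<Lambda> \<mu> + deg \<Lambda> \<nu>" "deg \<Lambda> (\<mu> \<cdot> \<nu>) = deg \<Lambda> \<mu>' + deg \<Lambda> \<nu>'"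
    using assms deg_cmp by metis+
  then have 2: "deg \<Lambda> \<nu> = deg \<Lambda> \<nu>'"
    using assms(8) by (auto simp: fun_eq_iff)
  let ?P = "\<lambda>(a, b). a \<in> Mor \<Lambda> \<and> b \<in> Mor \<Lambda> \<and> src \<Lambda> a = rng \<Lambda> b \<and>
    deg \<Lambda> a = deg \<Lambda> \<mu> \<and> deg \<Lambda> b = deg \<Lambda> \<nu> \<and> \<mu> \<cdot> \<nu> = a \<cdot> b"
  have ex1: "\<exists>!z. ?P z"
    by (rule unique_factorization[OF cmp_closed[OF assms(1-3)] 1(1)])
  have "?P (\<mu>, \<nu>)" "?P (\<mu>', \<nu>')"
    unfolding prod.case using assms 2 by metis+
  then have "(\<mu>, \<nu>) = (\<mu>', \<nu>')"
    by (rule trans[OF the1_equality[OF ex1, symmetric] the1_equality[OF ex1]])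
  then show ?thesis by simp
qed

lemma (in discrete_k_graph) vertices_eq_identities: "vertices \<Lambda> = rng \<Lambda> ` Mor \<Lambda>"
proof
  show "vertices \<Lambda> \<subseteq> rng \<Lambda> ` Mor \<Lambda>"
  proof
    fix v assume "v \<in> vertices \<Lambda>"
    then have v: "v \<in> Mor \<Lambda>" "deg \<Lambda> v = 0" by (auto simp: paths_of_degree_def)
    have "rng \<Lambda> v = v \<and> v = src \<Lambda> v"
      by (rule factorization_unique) (simp_all add: v rng_closed src_closed src_rng rng_src rng_id src_id deg_id)
    then show "v \<in> rng \<Lambda> ` Mor \<Lambda>" using v by force
  qed
qed (auto simp: paths_of_degree_def rng_closed deg_id)

lemma (in discrete_k_graph) ex1_segment:
  assumes "\<kappa> \<in> Mor \<Lambda>" "p \<le> q" "q \<le> deg \<Lambda> \<kappa>"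
  shows "\<exists>!\<xi>. is_segment \<Lambda> \<kappa> p q \<xi>"
proof (rule ex_ex1I)
  have "deg \<Lambda> \<kappa> = q + (deg \<Lambda> \<kappa> - q)" using assms(3) by (auto simp: fun_eq_iff le_fun_def)
  from ex1_implies_ex[OF unique_factorization[OF assms(1) this]] obtain \<mu> \<kappa>''
    where 1: "\<mu> \<in> Mor \<Lambda>" "\<kappa>'' \<in> Mor \<Lambda>" "src \<Lambda> \<mu> = rng \<Lambda> \<kappa>''" "deg \<Lambda> \<mu> = q"
      "deg \<Lambda> \<kappa>'' = deg \<Lambda> \<kappa> - q" "\<kappa> = \<mu> \<cdot> \<kappa>''" by blast
  have "deg \<Lambda> \<mu> = p + (q - p)" using assms(2) 1(4) by (auto simp: fun_eq_iff le_fun_def)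
  from ex1_implies_ex[OF unique_factorization[OF 1(1) this]] obtain \<kappa>' \<xi>
    where 2: "\<kappa>' \<in> Mor \<Lambda>" "\<xi> \<in> Mor \<Lambda>" "src \<Lambda> \<kappa>' = rng \<Lambda> \<xi>" "deg \<Lambda> \<kappa>' = p"
      "deg \<Lambda> \<xi> = q - p" "\<mu> = \<kappa>' \<cdot> \<xi>" by blast
  have "src \<Lambda> \<xi> = rng \<Lambda> \<kappa>''" using 1 2 src_cmp by metis
  then show "\<exists>\<xi>. is_segment \<Lambda> \<kappa> p q \<xi>"
    using 1 2 unfolding is_segment_def paths_of_degree_def by blast
next
  fix \<xi> \<eta> assume "is_segment \<Lambda> \<kappa> p q \<xi>" "is_segment \<Lambda> \<kappa> p q \<eta>"
  then obtain a b a' b' where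
    1: "\<xi> \<in> Mor \<Lambda>" "a \<in> Mor \<Lambda>" "b \<in> Mor \<Lambda>" "deg \<Lambda> \<xi> = q - p" "deg \<Lambda> a = p"
      "src \<Lambda> a = rng \<Lambda> \<xi>" "src \<Lambda> \<xi> = rng \<Lambda> b" "\<kappa> = a \<cdot> \<xi> \<cdot> b" and
    2: "\<eta> \<in> Mor \<Lambda>" "a' \<in> Mor \<Lambda>" "b' \<in> Mor \<Lambda>" "deg \<Lambda> \<eta> = q - p" "deg \<Lambda> a' = p"
      "src \<Lambda> a' = rng \<Lambda> \<eta>" "src \<Lambda> \<eta> = rng \<Lambda> b'" "\<kappa> = a' \<cdot> \<eta> \<cdot> b'"
    unfolding is_segment_def paths_of_degree_def by blast
  have "a \<cdot> \<xi> = a' \<cdot> \<eta> \<and> b = b'"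
    by (rule factorization_unique)
      (simp_all add: 1(1-7) 2(1-7) cmp_closed src_cmp deg_cmp 1(8)[symmetric] 2(8)[symmetric])
  then have "a = a' \<and> \<xi> = \<eta>"
    by (intro factorization_unique) (simp_all add: 1(1-7) 2(1-7))
  then show "\<xi> = \<eta>" ..
qed

lemma discrete_k_graph_Omega: "discrete_k_graph (Omega (m :: 'k::finite \<Rightarrow> enat))"
proof unfold_locales
  fix l :: "('k \<Rightarrow> nat) \<times> ('k \<Rightarrow> nat)" and a b :: "'k \<Rightarrow> nat"
  assume l: "l \<in> Mor (Omega m)" "deg (Omega m) l = a + b"
  obtain p q where [simp]: "l = (p, q)" by force
  have pq: "p \<le> q" "enat \<circ> q \<le> m" "q - p = a + b" using l by (auto simp: Omega_def)
  have q: "q = p + a + b"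
  proof
    fix i show "q i = (p + a + b) i"
      using le_funD[OF pq(1), of i] fun_cong[OF pq(3), of i] by simp
  qed
  have m: "enat \<circ> (p + a) \<le> m"
  proof (rule le_funI)
    fix i
    have "(enat \<circ> (p + a)) i \<le> (enat \<circ> q) i" by (simp add: q)
    also have "\<dots> \<le> m i" using pq(2) by (rule le_funD)
    finally show "(enat \<circ> (p + a)) i \<le> m i" .
  qed
  have le: "p \<le> p + a" "p + a \<le> q" by (simp_all add: q le_fun_def)
  have d: "p + a - p = a" "q - (p + a) = b" by (simp_all add: q fun_eq_iff)
  have eq: "u = v + w" if "v \<le> u" "u - v = w" for u v w :: "'k \<Rightarrow> nat"
  proof
    fix i show "u i = (v + w) i"
      using le_funD[OF that(1), of i] fun_cong[OF that(2), of i] by simp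
  qed
  show "\<exists>!(\<mu>, \<nu>). \<mu> \<in> Mor (Omega m) \<and> \<nu> \<in> Mor (Omega m) \<and> src (Omega m) \<mu> = rng (Omega m) \<nu> \<and>
      deg (Omega m) \<mu> = a \<and> deg (Omega m) \<nu> = b \<and> l = cmp (Omega m) \<mu> \<nu>"
    (is "\<exists>!z. case z of (\<mu>, \<nu>) \<Rightarrow> ?Q \<mu> \<nu>")
  proof (rule ex1I[of _ "((p, p + a), (p + a, q))"])
    show "case ((p, p + a), (p + a, q)) of (\<mu>, \<nu>) \<Rightarrow> ?Q \<mu> \<nu>"
      using m pq(2) le d by (simp add: Omega_def)
  next
    fix z assume "case z of (\<mu>, \<nu>) \<Rightarrow> ?Q \<mu> \<nu>"
    moreover obtain u v w t where z: "z = ((u, v), (w, t))"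
      by (metis surj_pair)
    ultimately have *: "?Q (u, v) (w, t)" by simp
    have "u = p" "w = v" "t = q" "u \<le> v" "v - u = a"
      using * by (auto simp: Omega_def)
    with eq[of u v a] show "z = ((p, p + a), (p + a, q))" by (simp add: z)
  qed
next
  fix l assume "l \<in> Mor (Omega m)"
  then obtain p q where l: "l = (p, q)" "p \<le> q" "enat \<circ> q \<le> m" by (auto simp: Omega_def)
  have "enat \<circ> p \<le> enat \<circ> q" using l(2) by (simp add: le_fun_def)
  then show "rng (Omega m) l \<in> Mor (Omega m)" using l by (auto simp: Omega_def)
next
  fix l k assume "l \<in> Mor (Omega m)" "k \<in> Mor (Omega m)" "src (Omega m) l = rng (Omega m) k"
  then show "deg (Omega m) (cmp (Omega m) l k) = deg (Omega m) l + deg (Omega m) k"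
    by (auto simp: Omega_def le_fun_def fun_eq_iff)
qed (auto simp: Omega_def fun_eq_iff)

lemma add_le_enat_diff:
  fixes d :: "'k \<Rightarrow> enat"
  assumes "enat \<circ> m \<le> d" "enat \<circ> q \<le> d - (enat \<circ> m)"
  shows "enat \<circ> (m + q) \<le> d"
  unfolding le_fun_def
proof
  fix i
  have "enat (m i) \<le> d i" "enat (q i) \<le> d i - enat (m i)"
    using assms by (auto simp: le_fun_def)
  then show "(enat \<circ> (m + q)) i \<le> d i" by (cases "d i") auto
qed

lemma (in discrete_k_graph) ex1_shift:
  assumes x: "x \<in> path_space \<Lambda>" and m: "enat \<circ> m \<le> pdeg x"
  shows "\<exists>!y. y \<in> path_space \<Lambda> \<and> pdeg y = pdeg x - (enat \<circ> m) \<and>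
     (\<forall>n. enat \<circ> n \<le> pdeg x - (enat \<circ> m) \<longrightarrow> pseg y 0 n = pseg x m (m + n))"
    (is "\<exists>!y. ?P y")
    and shift_eq: "shift \<Lambda> m x = (pdeg x - (enat \<circ> m),
      restrict (\<lambda>(p, q). pseg x (m + p) (m + q)) (Mor (Omega (pdeg x - (enat \<circ> m)))))"
    (is "_ = ?y")
proof -
  define d' where "d' = pdeg x - (enat \<circ> m)"
  have O: "(p, q) \<in> Mor (Omega e) \<longleftrightarrow> p \<le> q \<and> enat \<circ> q \<le> e" for p q and e :: "'k \<Rightarrow> enat"
    by (auto simp: Omega_def)
  have up: "enat \<circ> p \<le> e" if "p \<le> q" "enat \<circ> q \<le> e" for p q and e :: "'k \<Rightarrow> enat"
    using that by (auto simp: le_fun_def) (meson enat_ord_simps(1) order_trans)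
  have fx: "degree_functor (Omega (pdeg x)) \<Lambda> (snd x)"
    using x by (auto simp: path_space_def pdeg_def)
  have in_x: "(m + p, m + q) \<in> Mor (Omega (pdeg x))" if "(p, q) \<in> Mor (Omega d')" for p q
    using that add_le_enat_diff[OF m] by (auto simp: O d'_def le_fun_def)
  define h where "h = restrict (\<lambda>(p, q). pseg x (m + p) (m + q)) (Mor (Omega d'))"
  have h: "h (p, q) = snd x (m + p, m + q)" if "(p, q) \<in> Mor (Omega d')" for p q
    using that by (simp add: h_def pseg_def)
  have "degree_functor (Omega d') \<Lambda> h"
    unfolding degree_functor_def
  proof (intro conjI ballI impI)
    fix a assume a: "a \<in> Mor (Omega d')"
    obtain p q where [simp]: "a = (p, q)" by force
    have pq: "(p, q) \<in> Mor (Omega d')" using a by simp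
    have pp: "(p, p) \<in> Mor (Omega d')" "(q, q) \<in> Mor (Omega d')"
      using pq up by (auto simp: O)
    have dd: "(m + q) - (m + p) = q - p" by (auto simp: fun_eq_iff)
    have O': "rng (Omega e) (u, v) = (u, u)" "src (Omega e) (u, v) = (v, v)"
      "deg (Omega e) (u, v) = v - u" for u v and e :: "'k \<Rightarrow> enat"
      by (simp_all add: Omega_def)
    note F = fx[unfolded degree_functor_def, THEN conjunct1, THEN bspec, OF in_x[OF pq], unfolded O' dd]
    show "h a \<in> Mor \<Lambda>" "h (rng (Omega d') a) = rng \<Lambda> (h a)"
      "h (src (Omega d') a) = src \<Lambda> (h a)" "deg \<Lambda> (h a) = deg (Omega d') a"
      using F by (simp_all add: O' h pq pp)
  next
    fix a b assume ab: "a \<in> Mor (Omega d')" "b \<in> Mor (Omega d')" "src (Omega d') a = rng (Omega d') b"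
    obtain p q q' t where [simp]: "a = (p, q)" "b = (q', t)" by force
    have [simp]: "q' = q" using ab(3) by (simp add: Omega_def)
    have pq: "(p, q) \<in> Mor (Omega d')" "(q, t) \<in> Mor (Omega d')" using ab by simp_all
    then have pt: "(p, t) \<in> Mor (Omega d')" using order_trans by (auto simp: O)
    have "src (Omega (pdeg x)) (m + p, m + q) = rng (Omega (pdeg x)) (m + q, m + t)"
      by (simp add: Omega_def)
    note F = fx[unfolded degree_functor_def, THEN conjunct2, THEN bspec, OF in_x[OF pq(1)],
        THEN bspec, OF in_x[OF pq(2)], THEN mp, OF this]
    have "cmp (Omega e) (u, v) (v, w) = (u, w)" for u v w and e :: "'k \<Rightarrow> enat"
      by (simp add: Omega_def)
    then show "h (a \<cdot>\<^bsub>Omega d'\<^esub> b) = h a \<cdot> h b"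
      using F by (simp add: h pq pt)
  qed
  then have y_path: "?y \<in> path_space \<Lambda>"
    by (simp add: path_space_def h_def d'_def)
  have y_seg: "pseg ?y 0 n = pseg x m (m + n)" if "enat \<circ> n \<le> d'" for n
  proof -
    have "(0, n) \<in> Mor (Omega d')" using that by (simp add: O le_fun_def)
    then show ?thesis by (simp add: pseg_def d'_def)
  qed
  have P: "?P ?y"
    using y_path y_seg by (simp add: pdeg_def d'_def)
  have uniq: "y = z" if y: "?P y" and z: "?P z" for y z
  proof (rule prod_eqI)
    show dy: "fst y = fst z" using y z by (simp add: pdeg_def)
    have y': "snd y \<in> extensional (Mor (Omega d'))" "degree_functor (Omega d') \<Lambda> (snd y)"
      and z': "snd z \<in> extensional (Mor (Omega d'))" "degree_functor (Omega d') \<Lambda> (snd z)"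
      using y z by (auto simp: path_space_def pdeg_def d'_def)
    show "snd y = snd z"
    proof (rule extensionalityI[OF y'(1) z'(1)])
      fix a assume a: "a \<in> Mor (Omega d')"
      obtain p q where [simp]: "a = (p, q)" by force
      have pq: "(p, q) \<in> Mor (Omega d')" using a by simp
      have 0: "(0, p) \<in> Mor (Omega d')"
        using pq up by (auto simp: O le_fun_def)
      have c: "cmp (Omega d') (0, p) (p, q) = (0, q)" "src (Omega d') (0, p) = rng (Omega d') (p, q)"
        by (auto simp: Omega_def)
      have e: "snd y (0, p) = snd z (0, p)" "snd y (0, q) = snd z (0, q)"
        using y z pq up by (auto simp: pseg_def O d'_def)
      have "snd y (0, p) = snd z (0, p) \<and> snd y (p, q) = snd z (p, q)"
      proof (rule factorization_unique)
        show "snd y (0, p) \<cdot> snd y (p, q) = snd z (0, p) \<cdot> snd z (p, q)"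
          using y'(2) z'(2) 0 pq c e unfolding degree_functor_def by metis
      qed (use y'(2) z'(2) 0 pq c e in \<open>unfold degree_functor_def, metis+\<close>)
      then show "snd y a = snd z a" by simp
    qed
  qed
  show "\<exists>!y. ?P y" using P uniq by blast
  show "shift \<Lambda> m x = ?y"
    unfolding shift_def by (rule the_equality) (use P uniq in blast)+
qed

end

theory Submission
  imports Defs
begin

text \<open>
  The conditions are proved in the cycle (i) to (iii) to (ii) to (i). Throughout, say that
  \<open>\<alpha> \<noteq> \<beta>\<close> with common source \<open>w\<close> \<^emph>\<open>overlap\<close> if \<open>\<alpha>\<tau>\<close> and \<open>\<beta>\<tau>\<close> have a common extension for every
  \<open>\<tau> \<in> w\<Lambda>\<close>; condition (iii) says that there is no overlapping pair.

  An overlapping pair makes every boundary path \<open>x\<close> with range \<open>w\<close> periodic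
  (\<open>overlap_imp_periodic\<close>). The common extensions of \<open>\<alpha>\<tau>\<close> and \<open>\<beta>\<tau>\<close> for initial segments \<open>\<tau>\<close> of
  \<open>x\<close> say that \<open>\<alpha>x\<close> and \<open>\<beta>x\<close> are the same path. Deleting an initial segment of degree
  \<open>d(\<alpha>) \<or> d(\<beta>)\<close> from it in the two possible ways gives \<open>\<sigma>\<^sup>m x = \<sigma>\<^sup>n x\<close> with
  \<open>m = (d(\<alpha>) \<or> d(\<beta>)) - d(\<alpha>)\<close> and \<open>n = (d(\<alpha>) \<or> d(\<beta>)) - d(\<beta>)\<close>. This needs \<open>d(\<alpha>)\<close> and \<open>d(\<beta>)\<close> to
  agree in every coordinate in which \<open>x\<close> is finite, and here finite alignment and the boundary
  condition enter: the minimal common extensions of \<open>\<alpha>\<tau>\<close> and \<open>\<beta>\<tau>\<close> leave behind, after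
  \<open>\<beta>\<tau>\<close>, a finite exhaustive set, one of whose members \<open>x\<close> must follow; if \<open>d(\<alpha>)\<close> exceeded \<open>d(\<beta>)\<close>
  in a coordinate that \<open>\<tau>\<close> has already exhausted, \<open>x\<close> would be too short for this
  (\<open>overlap_deg_le_on_finite_coordinate\<close>).

  If (ii) fails at \<open>v, m, n\<close>, choose \<open>\<omega> \<in> v\<Lambda>\<close> of degree \<open>m \<or> n\<close>. Its final segments after \<open>m\<close> and
  after \<open>n\<close> then overlap, since a long extension \<open>\<omega>\<tau>\<rho>\<close> looks the same from position \<open>m\<close> as from
  position \<open>n\<close> (\<open>no_aperiodicity_imp_overlap\<close>).

  Given (ii), an infinite path with range \<open>v\<close> is built by running through the countably many pairs
  \<open>(m, n)\<close> and appending, at the stage of \<open>m \<noteq> n\<close>, a path that tells \<open>m\<close> from \<open>n\<close>. It does not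
  matter that this path is appended far from the start, because \<open>\<sigma>\<^sup>m x = \<sigma>\<^sup>n x\<close> implies
  \<open>\<sigma>\<^sup>m\<^sup>+\<^sup>p x = \<sigma>\<^sup>n\<^sup>+\<^sup>p x\<close> for all \<open>p\<close>. As infinite paths are boundary paths, this gives (i)
  (\<open>aperiodicity_imp_aperiodic_path\<close>).
\<close>

section \<open>Factorizations and initial paths\<close>

lemma enat_comp_le_trans:
  fixes d :: "'i \<Rightarrow> enat"
  assumes "p \<le> q" "enat \<circ> q \<le> d"
  shows "enat \<circ> p \<le> d"
proof -
  have "enat \<circ> p \<le> enat \<circ> q" using assms(1) by (simp add: le_fun_def)
  then show ?thesis using assms(2) by (rule order_trans)
qed

context discrete_k_graph
begin

lemma obtain_factorization:
  assumes "\<kappa> \<in> Mor \<Lambda>" "p \<le> deg \<Lambda> \<kappa>"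
  obtains \<mu> \<nu> where "\<mu> \<in> Mor \<Lambda>" "\<nu> \<in> Mor \<Lambda>" "src \<Lambda> \<mu> = rng \<Lambda> \<nu>"
    "deg \<Lambda> \<mu> = p" "deg \<Lambda> \<nu> = deg \<Lambda> \<kappa> - p" "\<kappa> = \<mu> \<cdot> \<nu>"
proof -
  have "deg \<Lambda> \<kappa> = p + (deg \<Lambda> \<kappa> - p)"
    using assms(2) by (auto simp: fun_eq_iff le_fun_def)
  from ex1_implies_ex[OF unique_factorization[OF assms(1) this]] show ?thesis
    using that by blast
qed

lemma cmp_left_cancel:
  assumes "\<mu> \<in> Mor \<Lambda>" "\<nu> \<in> Mor \<Lambda>" "\<nu>' \<in> Mor \<Lambda>" "src \<Lambda> \<mu> = rng \<Lambda> \<nu>" "src \<Lambda> \<mu> = rng \<Lambda> \<nu>'"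
    "\<mu> \<cdot> \<nu> = \<mu> \<cdot> \<nu>'"
  shows "\<nu> = \<nu>'"
  using factorization_unique[of \<mu> \<nu> \<mu> \<nu>'] assms by blast

lemma segment_cmp:
  assumes "\<mu> \<in> Mor \<Lambda>" "\<xi> \<in> Mor \<Lambda>" "\<nu> \<in> Mor \<Lambda>" "src \<Lambda> \<mu> = rng \<Lambda> \<xi>" "src \<Lambda> \<xi> = rng \<Lambda> \<nu>"
    and pq: "deg \<Lambda> \<mu> = p" "deg \<Lambda> \<mu> + deg \<Lambda> \<xi> = q"
  shows "segment \<Lambda> (\<mu> \<cdot> (\<xi> \<cdot> \<nu>)) p q = \<xi>"
  unfolding segment_def
proof (rule the1_equality[OF ex1_segment])
  have d: "deg \<Lambda> (\<mu> \<cdot> (\<xi> \<cdot> \<nu>)) = q + deg \<Lambda> \<nu>"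
    using assms(1-5) by (simp add: deg_cmp cmp_closed rng_cmp add.assoc flip: pq)
  show "\<mu> \<cdot> (\<xi> \<cdot> \<nu>) \<in> Mor \<Lambda>"
    using assms by (simp add: cmp_closed rng_cmp)
  show "p \<le> q" "q \<le> deg \<Lambda> (\<mu> \<cdot> (\<xi> \<cdot> \<nu>))"
    using pq d by (auto simp: le_fun_def)
  have "deg \<Lambda> \<xi> = q - p" "deg \<Lambda> \<nu> = deg \<Lambda> (\<mu> \<cdot> (\<xi> \<cdot> \<nu>)) - q"
    by (simp_all add: d flip: pq)
  moreover have "\<mu> \<cdot> (\<xi> \<cdot> \<nu>) = \<mu> \<cdot> \<xi> \<cdot> \<nu>"
    using assms by (simp add: cmp_assoc)
  ultimately show "is_segment \<Lambda> (\<mu> \<cdot> (\<xi> \<cdot> \<nu>)) p q \<xi>"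
    unfolding is_segment_def paths_of_degree_def using assms by blast
qed

text \<open>
  By unique factorization the initial paths of a fixed path are determined by their degrees, and
  degrees order them; so arguments about factorizations turn into comparisons of degrees.
\<close>
definition initial_path :: "'a \<Rightarrow> 'a \<Rightarrow> bool"  (infix "\<preceq>" 50) where
  "\<mu> \<preceq> \<kappa> \<longleftrightarrow> \<mu> \<in> Mor \<Lambda> \<and> (\<exists>\<nu> \<in> Mor \<Lambda>. src \<Lambda> \<mu> = rng \<Lambda> \<nu> \<and> \<kappa> = \<mu> \<cdot> \<nu>)"

lemma initial_pathI:
  "\<lbrakk>\<mu> \<in> Mor \<Lambda>; \<nu> \<in> Mor \<Lambda>; src \<Lambda> \<mu> = rng \<Lambda> \<nu>\<rbrakk> \<Longrightarrow> \<mu> \<preceq> \<mu> \<cdot> \<nu>"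
  by (auto simp: initial_path_def)

lemma initial_pathE:
  assumes "\<mu> \<preceq> \<kappa>"
  obtains \<nu> where "\<mu> \<in> Mor \<Lambda>" "\<nu> \<in> Mor \<Lambda>" "src \<Lambda> \<mu> = rng \<Lambda> \<nu>" "\<kappa> = \<mu> \<cdot> \<nu>"
  using assms by (auto simp: initial_path_def)

lemma initial_path_closed: "\<mu> \<preceq> \<kappa> \<Longrightarrow> \<mu> \<in> Mor \<Lambda> \<and> \<kappa> \<in> Mor \<Lambda> \<and> rng \<Lambda> \<mu> = rng \<Lambda> \<kappa>"
  by (auto simp: initial_path_def cmp_closed rng_cmp)

lemma initial_path_refl: "\<mu> \<in> Mor \<Lambda> \<Longrightarrow> \<mu> \<preceq> \<mu>"
  using initial_pathI[of \<mu> "src \<Lambda> \<mu>"] by (simp add: src_closed rng_src src_id)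

lemma initial_path_trans:
  assumes "\<mu> \<preceq> \<nu>" "\<nu> \<preceq> \<kappa>"
  shows "\<mu> \<preceq> \<kappa>"
proof -
  obtain a where a: "\<mu> \<in> Mor \<Lambda>" "a \<in> Mor \<Lambda>" "src \<Lambda> \<mu> = rng \<Lambda> a" "\<nu> = \<mu> \<cdot> a"
    using assms(1) by (rule initial_pathE)
  obtain b where b: "\<nu> \<in> Mor \<Lambda>" "b \<in> Mor \<Lambda>" "src \<Lambda> \<nu> = rng \<Lambda> b" "\<kappa> = \<nu> \<cdot> b"
    using assms(2) by (rule initial_pathE)
  have s: "src \<Lambda> a = rng \<Lambda> b"
    using a b by (simp add: src_cmp)
  have "\<kappa> = \<mu> \<cdot> (a \<cdot> b)"
    using a b s by (simp add: cmp_assoc)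
  then show ?thesis
    using a b s initial_pathI[of \<mu> "a \<cdot> b"] by (simp add: cmp_closed rng_cmp)
qed

lemma initial_path_deg_le: "\<mu> \<preceq> \<kappa> \<Longrightarrow> deg \<Lambda> \<mu> \<le> deg \<Lambda> \<kappa>"
  by (auto simp: initial_path_def deg_cmp le_fun_def)

lemma initial_path_deg_eq:
  assumes "\<mu> \<preceq> \<kappa>" "deg \<Lambda> \<kappa> \<le> deg \<Lambda> \<mu>"
  shows "\<mu> = \<kappa>"
proof -
  obtain a where a: "\<mu> \<in> Mor \<Lambda>" "a \<in> Mor \<Lambda>" "src \<Lambda> \<mu> = rng \<Lambda> a" "\<kappa> = \<mu> \<cdot> a"
    using assms(1) by (rule initial_pathE)
  have k: "\<kappa> \<in> Mor \<Lambda>" using a by (simp add: cmp_closed)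
  have "deg \<Lambda> \<mu> = deg \<Lambda> \<kappa>"
    using assms initial_path_deg_le by (simp add: order_antisym)
  then have "\<mu> = \<kappa> \<and> a = src \<Lambda> \<kappa>"
    by (intro factorization_unique a(1-3) k)
      (simp_all add: k src_closed rng_src src_id flip: a(4))
  then show ?thesis ..
qed

lemma obtain_initial_path:
  assumes "\<kappa> \<in> Mor \<Lambda>" "p \<le> deg \<Lambda> \<kappa>"
  obtains \<mu> where "\<mu> \<preceq> \<kappa>" "deg \<Lambda> \<mu> = p"
  using obtain_factorization[OF assms] initial_pathI by metis

text \<open>
  The initial path of \<open>\<nu>\<close> of degree \<open>d(\<mu>)\<close> is also an initial path of \<open>\<kappa>\<close>, hence is \<open>\<mu>\<close>. Degrees
  are only partially ordered, so without the hypothesis on degrees neither of \<open>\<mu>\<close> and \<open>\<nu>\<close> needs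
  to extend the other.
\<close>
lemma initial_path_comparable:
  assumes "\<mu> \<preceq> \<kappa>" "\<nu> \<preceq> \<kappa>" "deg \<Lambda> \<mu> \<le> deg \<Lambda> \<nu>"
  shows "\<mu> \<preceq> \<nu>"
proof -
  obtain \<mu>' where m: "\<mu>' \<preceq> \<nu>" "deg \<Lambda> \<mu>' = deg \<Lambda> \<mu>"
    using obtain_initial_path[of \<nu> "deg \<Lambda> \<mu>"] assms initial_path_closed by blast
  have "\<mu>' \<preceq> \<kappa>" using m assms initial_path_trans by blast
  then have "\<mu>' = \<mu>"
    using assms(1) m(2) factorization_unique unfolding initial_path_def by metis
  then show ?thesis using m by simp
qed

lemma initial_path_unique:
  "\<lbrakk>\<mu> \<preceq> \<kappa>; \<nu> \<preceq> \<kappa>; deg \<Lambda> \<mu> = deg \<Lambda> \<nu>\<rbrakk> \<Longrightarrow> \<mu> = \<nu>"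
  using initial_path_comparable[of \<mu> \<kappa> \<nu>] initial_path_deg_eq[of \<mu> \<nu>] by simp

lemma initial_path_left_cancel:
  assumes "\<alpha> \<in> Mor \<Lambda>" "\<mu> \<in> Mor \<Lambda>" "\<kappa> \<in> Mor \<Lambda>" "src \<Lambda> \<alpha> = rng \<Lambda> \<mu>" "src \<Lambda> \<alpha> = rng \<Lambda> \<kappa>"
  shows "\<alpha> \<cdot> \<mu> \<preceq> \<alpha> \<cdot> \<kappa> \<longleftrightarrow> \<mu> \<preceq> \<kappa>"
proof
  assume "\<mu> \<preceq> \<kappa>"
  then obtain a where a: "a \<in> Mor \<Lambda>" "src \<Lambda> \<mu> = rng \<Lambda> a" "\<kappa> = \<mu> \<cdot> a"
    by (rule initial_pathE)
  then have "\<alpha> \<cdot> \<kappa> = \<alpha> \<cdot> \<mu> \<cdot> a" using assms by (simp add: cmp_assoc)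
  then show "\<alpha> \<cdot> \<mu> \<preceq> \<alpha> \<cdot> \<kappa>"
    using a assms initial_pathI[of "\<alpha> \<cdot> \<mu>" a] by (simp add: cmp_closed src_cmp)
next
  assume "\<alpha> \<cdot> \<mu> \<preceq> \<alpha> \<cdot> \<kappa>"
  then obtain a where a: "a \<in> Mor \<Lambda>" "src \<Lambda> (\<alpha> \<cdot> \<mu>) = rng \<Lambda> a" "\<alpha> \<cdot> \<kappa> = \<alpha> \<cdot> \<mu> \<cdot> a"
    by (rule initial_pathE)
  have s: "src \<Lambda> \<mu> = rng \<Lambda> a" using a assms by (simp add: src_cmp)
  have "\<alpha> \<cdot> \<kappa> = \<alpha> \<cdot> (\<mu> \<cdot> a)" using a s assms by (simp add: cmp_assoc)
  moreover have "\<mu> \<cdot> a \<in> Mor \<Lambda>" "rng \<Lambda> (\<mu> \<cdot> a) = rng \<Lambda> \<mu>"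
    using assms(2) a(1) s by (simp_all add: cmp_closed rng_cmp)
  ultimately have "\<kappa> = \<mu> \<cdot> a"
    using cmp_left_cancel assms by metis
  then show "\<mu> \<preceq> \<kappa>" using initial_pathI[of \<mu> a] a s assms by simp
qed

lemma MCE_iff_initial_path:
  assumes "\<mu> \<in> Mor \<Lambda>" "\<nu> \<in> Mor \<Lambda>"
  shows "\<kappa> \<in> MCE \<Lambda> \<mu> \<nu> \<longleftrightarrow> \<mu> \<preceq> \<kappa> \<and> \<nu> \<preceq> \<kappa> \<and> deg \<Lambda> \<kappa> = sup (deg \<Lambda> \<mu>) (deg \<Lambda> \<nu>)"
  using assms initial_path_closed[of \<mu> \<kappa>] unfolding MCE_def initial_path_def by blast

lemma MCE_commute: "MCE \<Lambda> \<mu> \<nu> = MCE \<Lambda> \<nu> \<mu>"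
  by (auto simp: MCE_def sup_commute)

text \<open>
  Truncating a common extension to degree \<open>d(\<mu>) \<or> d(\<nu>)\<close> keeps it a common extension; hence
  \<open>MCE(\<mu>, \<nu>)\<close> is nonempty as soon as there is any common extension.
\<close>
lemma common_extension_MCE:
  assumes "\<mu> \<preceq> \<kappa>" "\<nu> \<preceq> \<kappa>"
  obtains \<xi> where "\<xi> \<in> MCE \<Lambda> \<mu> \<nu>" "\<xi> \<preceq> \<kappa>"
proof -
  have "sup (deg \<Lambda> \<mu>) (deg \<Lambda> \<nu>) \<le> deg \<Lambda> \<kappa>"
    using assms by (simp add: initial_path_deg_le)
  then obtain \<xi> where x: "\<xi> \<preceq> \<kappa>" "deg \<Lambda> \<xi> = sup (deg \<Lambda> \<mu>) (deg \<Lambda> \<nu>)"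
    using obtain_initial_path assms initial_path_closed by metis
  then have "\<mu> \<preceq> \<xi>" "\<nu> \<preceq> \<xi>"
    using assms by (auto intro: initial_path_comparable)
  then have "\<xi> \<in> MCE \<Lambda> \<mu> \<nu>"
    using x assms MCE_iff_initial_path initial_path_closed by blast
  then show ?thesis using x that by blast
qed

lemma no_sources_obtain:
  assumes "no_sources \<Lambda>" "v \<in> vertices \<Lambda>"
  obtains \<kappa> where "\<kappa> \<in> Mor \<Lambda>" "rng \<Lambda> \<kappa> = v" "deg \<Lambda> \<kappa> = n"
  using assms unfolding no_sources_def is_source_def with_range_def paths_of_degree_def by blast

lemma src_vertex: "\<kappa> \<in> Mor \<Lambda> \<Longrightarrow> src \<Lambda> \<kappa> \<in> vertices \<Lambda>"
  unfolding vertices_eq_identities using rng_src src_closed by (metis imageI)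

lemma vertex_rng: "v \<in> vertices \<Lambda> \<Longrightarrow> v \<in> Mor \<Lambda> \<and> rng \<Lambda> v = v \<and> src \<Lambda> v = v"
  unfolding vertices_eq_identities by (auto simp: rng_closed rng_rng src_rng)

section \<open>Local periodicity produces overlapping paths\<close>

text \<open>
  Write a path \<open>\<omega> \<in> v\<Lambda>\<close> of degree \<open>m \<or> n\<close> as \<open>a\<alpha> = b\<beta>\<close> with \<open>d(a) = m\<close> and \<open>d(b) = n\<close>. In
  \<open>\<omega>\<tau>\<rho> = a(\<alpha>\<tau>\<rho>) = b(\<beta>\<tau>\<rho>)\<close>, periodicity identifies long initial paths of \<open>\<alpha>\<tau>\<rho>\<close> and \<open>\<beta>\<tau>\<rho>\<close>. Once
  \<open>\<rho>\<close> has degree \<open>m \<or> n\<close>, they are long enough to contain \<open>\<alpha>\<tau>\<close> and \<open>\<beta>\<tau>\<close>.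
\<close>
lemma no_aperiodicity_imp_overlap:
  assumes ns: "no_sources \<Lambda>" and v: "v \<in> vertices \<Lambda>" and "m \<noteq> n"
    and per: "\<And>\<kappa>. \<lbrakk>\<kappa> \<in> Mor \<Lambda>; rng \<Lambda> \<kappa> = v; sup m n \<le> deg \<Lambda> \<kappa>\<rbrakk> \<Longrightarrow>
      segment \<Lambda> \<kappa> m (m + deg \<Lambda> \<kappa> - sup m n) = segment \<Lambda> \<kappa> n (n + deg \<Lambda> \<kappa> - sup m n)"
  obtains \<alpha> \<beta> where "\<alpha> \<in> Mor \<Lambda>" "\<beta> \<in> Mor \<Lambda>" "\<alpha> \<noteq> \<beta>" "src \<Lambda> \<alpha> = src \<Lambda> \<beta>"
    "\<And>\<tau>. \<lbrakk>\<tau> \<in> Mor \<Lambda>; rng \<Lambda> \<tau> = src \<Lambda> \<alpha>\<rbrakk> \<Longrightarrow> MCE \<Lambda> (\<alpha> \<cdot> \<tau>) (\<beta> \<cdot> \<tau>) \<noteq> {}"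
proof -
  let ?N = "sup m n"
  obtain \<omega> where w: "\<omega> \<in> Mor \<Lambda>" "rng \<Lambda> \<omega> = v" "deg \<Lambda> \<omega> = ?N"
    using no_sources_obtain[OF ns v] .
  obtain a \<alpha> where a: "a \<in> Mor \<Lambda>" "\<alpha> \<in> Mor \<Lambda>" "src \<Lambda> a = rng \<Lambda> \<alpha>"
    "deg \<Lambda> a = m" "deg \<Lambda> \<alpha> = ?N - m" "\<omega> = a \<cdot> \<alpha>"
    using obtain_factorization[OF w(1), where p = m, unfolded w(3), OF sup_ge1] .
  obtain b \<beta> where b: "b \<in> Mor \<Lambda>" "\<beta> \<in> Mor \<Lambda>" "src \<Lambda> b = rng \<Lambda> \<beta>"
    "deg \<Lambda> b = n" "deg \<Lambda> \<beta> = ?N - n" "\<omega> = b \<cdot> \<beta>"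
    using obtain_factorization[OF w(1), where p = n, unfolded w(3), OF sup_ge2] .
  have s: "src \<Lambda> \<alpha> = src \<Lambda> \<omega>" "src \<Lambda> \<beta> = src \<Lambda> \<omega>"
    using a b src_cmp by metis+
  have "?N - m \<noteq> ?N - n"
  proof
    assume e: "?N - m = ?N - n"
    have "m i = n i" for i
      using fun_cong[OF e, of i] by (simp add: sup_max max_def split: if_splits)
    then show False using \<open>m \<noteq> n\<close> by auto
  qed
  then have "\<alpha> \<noteq> \<beta>" using a b by auto
  moreover have "MCE \<Lambda> (\<alpha> \<cdot> \<tau>) (\<beta> \<cdot> \<tau>) \<noteq> {}" if t: "\<tau> \<in> Mor \<Lambda>" "rng \<Lambda> \<tau> = src \<Lambda> \<alpha>" for \<tau>
  proof -
    obtain \<rho> where r: "\<rho> \<in> Mor \<Lambda>" "rng \<Lambda> \<rho> = src \<Lambda> \<tau>" "deg \<Lambda> \<rho> = ?N"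
      using no_sources_obtain[OF ns src_vertex[OF t(1)]] .
    let ?\<kappa> = "\<omega> \<cdot> (\<tau> \<cdot> \<rho>)" and ?d = "deg \<Lambda> \<tau> + ?N"
    have \<tau>\<rho>: "\<tau> \<cdot> \<rho> \<in> Mor \<Lambda>" "rng \<Lambda> (\<tau> \<cdot> \<rho>) = src \<Lambda> \<omega>" "deg \<Lambda> (\<tau> \<cdot> \<rho>) = ?d"
      using t r s by (simp_all add: cmp_closed rng_cmp deg_cmp)
    have k: "?\<kappa> \<in> Mor \<Lambda>" "rng \<Lambda> ?\<kappa> = v" "deg \<Lambda> ?\<kappa> = ?N + ?d"
      using w \<tau>\<rho> by (simp_all add: cmp_closed rng_cmp deg_cmp)
    \<comment> \<open>both cases, \<open>(a, \<alpha>)\<close> at \<open>m\<close> and \<open>(b, \<beta>)\<close> at \<open>n\<close>, at once\<close>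
    have read: "\<exists>\<gamma>. \<gamma> = segment \<Lambda> ?\<kappa> p (p + deg \<Lambda> ?\<kappa> - ?N) \<and> \<xi> \<cdot> \<tau> \<preceq> \<gamma>"
      if c: "c \<in> Mor \<Lambda>" "\<xi> \<in> Mor \<Lambda>" "src \<Lambda> c = rng \<Lambda> \<xi>"
        "deg \<Lambda> c = p" "deg \<Lambda> \<xi> = ?N - p" "\<omega> = c \<cdot> \<xi>" and p: "p \<le> ?N" for c \<xi> p
    proof -
      have sx: "src \<Lambda> \<xi> = src \<Lambda> \<omega>" using c src_cmp by metis
      have x: "\<xi> \<cdot> (\<tau> \<cdot> \<rho>) \<in> Mor \<Lambda>" "rng \<Lambda> (\<xi> \<cdot> (\<tau> \<cdot> \<rho>)) = src \<Lambda> c"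
        "deg \<Lambda> (\<xi> \<cdot> (\<tau> \<cdot> \<rho>)) = ?N - p + ?d"
        using c \<tau>\<rho> sx by (simp_all add: cmp_closed rng_cmp deg_cmp)
      obtain \<gamma> \<delta> where g: "\<gamma> \<in> Mor \<Lambda>" "\<delta> \<in> Mor \<Lambda>" "src \<Lambda> \<gamma> = rng \<Lambda> \<delta>"
        "deg \<Lambda> \<gamma> = ?d" "\<xi> \<cdot> (\<tau> \<cdot> \<rho>) = \<gamma> \<cdot> \<delta>"
      proof (rule obtain_factorization[OF x(1)])
        show "?d \<le> deg \<Lambda> (\<xi> \<cdot> (\<tau> \<cdot> \<rho>))" unfolding x by (simp add: le_fun_def)
      qed
      have "rng \<Lambda> \<gamma> = src \<Lambda> c" using g x rng_cmp by metis
      moreover have "?\<kappa> = c \<cdot> (\<gamma> \<cdot> \<delta>)"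
        using c \<tau>\<rho> sx by (simp add: cmp_assoc flip: g(5))
      moreover have "p + deg \<Lambda> ?\<kappa> - ?N = p + ?d"
        unfolding k by (auto simp: fun_eq_iff)
      ultimately have "\<gamma> = segment \<Lambda> ?\<kappa> p (p + deg \<Lambda> ?\<kappa> - ?N)"
        using segment_cmp[of c \<gamma> \<delta> p "p + ?d"] c g by simp
      moreover have "\<xi> \<cdot> \<tau> \<preceq> \<gamma>"
      proof (rule initial_path_comparable)
        show "\<gamma> \<preceq> \<xi> \<cdot> (\<tau> \<cdot> \<rho>)" using g initial_pathI by simp
        show "\<xi> \<cdot> \<tau> \<preceq> \<xi> \<cdot> (\<tau> \<cdot> \<rho>)"
          using initial_pathI[of \<tau> \<rho>] initial_path_left_cancel[of \<xi> \<tau> "\<tau> \<cdot> \<rho>"] c t r s sx \<tau>\<rho> by simp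
        show "deg \<Lambda> (\<xi> \<cdot> \<tau>) \<le> deg \<Lambda> \<gamma>"
          using c t sx s g by (simp add: deg_cmp le_fun_def)
      qed
      ultimately show ?thesis by blast
    qed
    have "segment \<Lambda> ?\<kappa> m (m + deg \<Lambda> ?\<kappa> - ?N) = segment \<Lambda> ?\<kappa> n (n + deg \<Lambda> ?\<kappa> - ?N)"
      using k by (intro per) (simp_all add: le_fun_def)
    then obtain \<gamma> where "\<alpha> \<cdot> \<tau> \<preceq> \<gamma>" "\<beta> \<cdot> \<tau> \<preceq> \<gamma>"
      using read[OF a] read[OF b] by auto
    then show ?thesis using common_extension_MCE by blast
  qed
  ultimately show ?thesis using that a b s by metis
qed

section \<open>Infinite paths\<close>

lemma path_space_pseg:
  assumes "x \<in> path_space \<Lambda>" "p \<le> q" "enat \<circ> q \<le> pdeg x"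
  shows "pseg x p q \<in> Mor \<Lambda>" "rng \<Lambda> (pseg x p q) = pseg x p p"
    "src \<Lambda> (pseg x p q) = pseg x q q" "deg \<Lambda> (pseg x p q) = q - p"
proof -
  have "(p, q) \<in> Mor (Omega (pdeg x))" using assms by (simp add: Omega_def)
  moreover have "degree_functor (Omega (pdeg x)) \<Lambda> (snd x)"
    using assms(1) by (auto simp: path_space_def pdeg_def)
  ultimately have F: "snd x (p, q) \<in> Mor \<Lambda>"
    "snd x (rng (Omega (pdeg x)) (p, q)) = rng \<Lambda> (snd x (p, q))"
    "snd x (src (Omega (pdeg x)) (p, q)) = src \<Lambda> (snd x (p, q))"
    "deg \<Lambda> (snd x (p, q)) = deg (Omega (pdeg x)) (p, q)"
    unfolding degree_functor_def by blast+
  then show "pseg x p q \<in> Mor \<Lambda>" "rng \<Lambda> (pseg x p q) = pseg x p p"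
    "src \<Lambda> (pseg x p q) = pseg x q q" "deg \<Lambda> (pseg x p q) = q - p"
    by (simp_all add: pseg_def Omega_def)
qed

lemma pseg_cmp:
  assumes "x \<in> path_space \<Lambda>" "p \<le> q" "q \<le> t" "enat \<circ> t \<le> pdeg x"
  shows "pseg x p t = pseg x p q \<cdot> pseg x q t"
proof -
  have "(p, q) \<in> Mor (Omega (pdeg x))" "(q, t) \<in> Mor (Omega (pdeg x))"
    using assms enat_comp_le_trans by (auto simp: Omega_def)
  moreover have "degree_functor (Omega (pdeg x)) \<Lambda> (snd x)"
    using assms(1) by (auto simp: path_space_def pdeg_def)
  moreover have "src (Omega (pdeg x)) (p, q) = rng (Omega (pdeg x)) (q, t)"
    by (simp add: Omega_def)
  ultimately have "snd x (cmp (Omega (pdeg x)) (p, q) (q, t)) = snd x (p, q) \<cdot> snd x (q, t)"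
    unfolding degree_functor_def by blast
  then show ?thesis by (simp add: pseg_def Omega_def)
qed

text \<open>
  Let \<open>E\<close> be finite and exhaustive, and follow \<open>x\<close> from \<open>m\<close> by a degree \<open>N\<close> that dominates all
  degrees in \<open>E\<close>. The resulting segment has a minimal common extension with some \<open>\<mu> \<in> E\<close>, whose
  degree is only \<open>N\<close>; so the segment itself extends \<open>\<mu>\<close>.
\<close>
lemma infinite_path_boundary:
  assumes x: "x \<in> path_space \<Lambda>" and inf: "pdeg x = (\<lambda>_. \<infinity>)"
  shows "x \<in> boundary_paths \<Lambda>"
  unfolding boundary_paths_def
proof (intro CollectI conjI x allI impI)
  fix m E assume E: "compact_exhaustive \<Lambda> (pseg x m m) E"
  have le: "enat \<circ> q \<le> pdeg x" for q by (simp add: inf le_fun_def)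
  define N where "N = (\<lambda>i. \<Sum>\<mu>\<in>E. deg \<Lambda> \<mu> i)"
  have N: "deg \<Lambda> \<mu> \<le> N" if "\<mu> \<in> E" for \<mu>
    using E that by (auto simp: N_def le_fun_def compact_exhaustive_def intro!: member_le_sum)
  let ?\<kappa> = "pseg x m (m + N)"
  have mN: "m \<le> m + N" by (simp add: le_fun_def)
  note K = path_space_pseg[OF x mN le]
  have "?\<kappa> \<in> with_range \<Lambda> (rng \<Lambda> ` E) (Mor \<Lambda>)"
    using K E by (simp add: with_range_def compact_exhaustive_def)
  then have "\<exists>\<mu> \<in> E. MCE \<Lambda> ?\<kappa> \<mu> \<noteq> {}"
    using E unfolding compact_exhaustive_def by blast
  then obtain \<mu> \<xi> where \<mu>: "\<mu> \<in> E" "\<xi> \<in> MCE \<Lambda> ?\<kappa> \<mu>"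
    by blast
  have dk: "deg \<Lambda> ?\<kappa> = N" using K(4) by (simp add: fun_eq_iff)
  have "\<mu> \<in> Mor \<Lambda>" using E \<mu> by (auto simp: compact_exhaustive_def)
  then have \<xi>: "?\<kappa> \<preceq> \<xi>" "\<mu> \<preceq> \<xi>" "deg \<Lambda> \<xi> = sup N (deg \<Lambda> \<mu>)"
    using \<mu> K dk by (simp_all add: MCE_iff_initial_path)
  then have "?\<kappa> = \<xi>" using N[OF \<mu>(1)] dk by (intro initial_path_deg_eq) simp_all
  then have \<mu>\<kappa>: "\<mu> \<preceq> ?\<kappa>" using \<xi> by simp
  have l: "m \<le> m + deg \<Lambda> \<mu>" "m + deg \<Lambda> \<mu> \<le> m + N"
    using N[OF \<mu>(1)] by (simp_all add: le_fun_def)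
  have "pseg x m (m + deg \<Lambda> \<mu>) \<preceq> ?\<kappa>"
    unfolding pseg_cmp[OF x l le]
    using path_space_pseg[OF x l(1) le] path_space_pseg[OF x l(2) le] by (intro initial_pathI) simp_all
  moreover have "deg \<Lambda> (pseg x m (m + deg \<Lambda> \<mu>)) = deg \<Lambda> \<mu>"
    using path_space_pseg(4)[OF x l(1) le] by (simp add: fun_eq_iff)
  ultimately have "pseg x m (m + deg \<Lambda> \<mu>) = \<mu>"
    using \<mu>\<kappa> initial_path_unique by blast
  then show "\<exists>\<kappa>\<in>E. enat \<circ> (m + deg \<Lambda> \<kappa>) \<le> pdeg x \<and> pseg x m (m + deg \<Lambda> \<kappa>) = \<kappa>"
    using \<mu>(1) le by blast
qed

text \<open>
  The union of a chain of paths of unbounded degrees: let \<open>y q\<close> be the path of degree \<open>q\<close> that is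
  initial in some member of the chain, and \<open>x(p, q)\<close> the path by which \<open>y q\<close> extends \<open>y p\<close>.
  Functoriality is then left cancellation.
\<close>
lemma infinite_path_of_chain:
  assumes chain: "\<And>j. L j \<preceq> L (Suc j)" and unbdd: "\<And>q. \<exists>j. q \<le> deg \<Lambda> (L j)"
  obtains x where "x \<in> path_space \<Lambda>" "pdeg x = (\<lambda>_. \<infinity>)" "\<And>j. pseg x 0 (deg \<Lambda> (L j)) = L j"
proof -
  have L: "L j \<in> Mor \<Lambda>" for j using chain initial_path_closed by blast
  have mono: "L i \<preceq> L j" if "i \<le> j" for i j
    using that by (induction rule: dec_induct) (auto intro: initial_path_refl L initial_path_trans chain)
  have "\<exists>y. deg \<Lambda> y = q \<and> (\<exists>j. y \<preceq> L j)" for q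
    using unbdd[of q] obtain_initial_path[OF L] by metis
  then obtain y where y: "deg \<Lambda> (y q) = q" "\<exists>j. y q \<preceq> L j" for q
    by metis
  have y_le: "\<mu> \<preceq> \<nu>" if "\<mu> \<preceq> L i" "\<nu> \<preceq> L j" "deg \<Lambda> \<mu> \<le> deg \<Lambda> \<nu>" for \<mu> \<nu> i j
    using that mono[of i "max i j"] mono[of j "max i j"]
      initial_path_trans initial_path_comparable by (metis max.cobounded1 max.cobounded2)
  have y_mono: "y p \<preceq> y q" if "p \<le> q" for p q
    using y_le y that by metis
  have yM: "y p \<in> Mor \<Lambda>" for p
    using y_mono[of p p] initial_path_closed by blast
  have "\<exists>a. p \<le> q \<longrightarrow> a \<in> Mor \<Lambda> \<and> src \<Lambda> (y p) = rng \<Lambda> a \<and> y q = y p \<cdot> a" for p q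
    using y_mono[of p q] unfolding initial_path_def by blast
  then obtain f where f: "f p q \<in> Mor \<Lambda>" "rng \<Lambda> (f p q) = src \<Lambda> (y p)" "y q = y p \<cdot> f p q"
    if "p \<le> q" for p q
    by metis
  have src_f: "src \<Lambda> (f p q) = src \<Lambda> (y q)" if "p \<le> q" for p q
    using f[OF that] yM src_cmp by metis
  have deg_f: "deg \<Lambda> (f p q) = q - p" if "p \<le> q" for p q
  proof -
    have "q = p + deg \<Lambda> (f p q)" using f[OF that] yM deg_cmp y(1) by metis
    then show ?thesis by (metis add_diff_cancel_left')
  qed
  have f_id: "f p p = src \<Lambda> (y p)" for p
  proof (rule cmp_left_cancel[OF yM[of p]])
    show "y p \<cdot> f p p = y p \<cdot> src \<Lambda> (y p)"
      using f(3)[of p p] yM[of p] by (simp add: src_id)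
  qed (simp_all add: f(1,2) yM src_closed rng_src)
  have f_cmp: "f p t = f p q \<cdot> f q t" if "p \<le> q" "q \<le> t" for p q t
  proof (rule cmp_left_cancel[of "y p"])
    have pt: "p \<le> t" using that by order
    note F = f[OF that(1)] f[OF that(2)] f[OF pt] src_f[OF that(1)] yM[of p]
    show "y p \<cdot> f p t = y p \<cdot> (f p q \<cdot> f q t)"
      using F cmp_assoc[of "y p" "f p q" "f q t"] by simp
  qed (use f[OF that(1)] f[OF that(2)] f[of p t] src_f[OF that(1)] yM[of p] that
        in \<open>auto simp: cmp_closed rng_cmp\<close>)
  define \<Omega> where "\<Omega> = Omega ((\<lambda>_. \<infinity>) :: 'k \<Rightarrow> enat)"
  have O: "Mor \<Omega> = {(p, q). p \<le> q}" "rng \<Omega> = (\<lambda>(p, q). (p, p))" "src \<Omega> = (\<lambda>(p, q). (q, q))"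
    "cmp \<Omega> = (\<lambda>(p, q) (q', t). (p, t))" "deg \<Omega> = (\<lambda>(p, q). q - p)"
    by (auto simp: \<Omega>_def Omega_def le_fun_def)
  define x where "x = ((\<lambda>_. \<infinity>) :: 'k \<Rightarrow> enat, restrict (\<lambda>(p, q). f p q) (Mor \<Omega>))"
  have "degree_functor \<Omega> \<Lambda> (snd x)"
    unfolding degree_functor_def x_def snd_conv
    by (auto simp: O f src_f deg_f f_id intro: f_cmp dest: order_trans)
  then have "x \<in> path_space \<Lambda>"
    by (auto simp: path_space_def x_def \<Omega>_def)
  moreover have "pdeg x = (\<lambda>_. \<infinity>)" by (simp add: pdeg_def x_def)
  moreover have "pseg x 0 (deg \<Lambda> (L j)) = L j" for j
  proof -
    have 0: "0 \<le> deg \<Lambda> (L j)" by (simp add: le_fun_def)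
    have "y 0 \<in> vertices \<Lambda>" using yM y by (simp add: paths_of_degree_def)
    then have "y 0 = src \<Lambda> (y 0)" using vertex_rng by simp
    then have "y (deg \<Lambda> (L j)) = f 0 (deg \<Lambda> (L j))"
      using f[OF 0] rng_id by metis
    moreover have "y (deg \<Lambda> (L j)) = L j"
    proof -
      obtain i where "y (deg \<Lambda> (L j)) \<preceq> L i" using y by blast
      then have "y (deg \<Lambda> (L j)) \<preceq> L j"
        using y_le[of _ i "L j" j] initial_path_refl[OF L] y(1) by simp
      then show ?thesis using initial_path_deg_eq y(1) by simp
    qed
    ultimately show ?thesis by (simp add: pseg_def x_def O 0)
  qed
  ultimately show ?thesis using that by blast
qed

lemma segment_pseg:
  assumes x: "x \<in> path_space \<Lambda>" and "p \<le> q" "q \<le> t" "t \<le> u" "enat \<circ> u \<le> pdeg x"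
  shows "segment \<Lambda> (pseg x p u) (q - p) (t - p) = pseg x q t"
proof -
  have le: "q \<le> u" "enat \<circ> t \<le> pdeg x" "enat \<circ> q \<le> pdeg x"
    using assms enat_comp_le_trans by (blast intro: order_trans)+
  note S = path_space_pseg[OF x assms(2) le(3)] path_space_pseg[OF x assms(3) le(2)]
    path_space_pseg[OF x assms(4,5)]
  have "pseg x p u = pseg x p q \<cdot> (pseg x q t \<cdot> pseg x t u)"
    using pseg_cmp[OF x assms(2) le(1) assms(5)] pseg_cmp[OF x assms(3-5)] by simp
  moreover have "(q - p) + (t - q) = t - p"
    using assms(2,3) by (auto simp: fun_eq_iff le_fun_def)
  ultimately show ?thesis using S by (simp add: segment_cmp)
qed

section \<open>Construction of an aperiodic path\<close>

text \<open>
  If \<open>\<sigma>\<^sup>m x = \<sigma>\<^sup>n x\<close>, then \<open>x\<close> looks the same from \<open>m + p\<close> as from \<open>n + p\<close>. For the \<open>p\<close> at which a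
  path \<open>\<kappa>\<close> that tells \<open>m\<close> from \<open>n\<close> was inserted, this equates the two segments of \<open>\<kappa>\<close> that differ.
\<close>
lemma aperiodicity_imp_aperiodic_path:
  assumes ns: "no_sources \<Lambda>" and v: "v \<in> vertices \<Lambda>"
    and sep: "\<And>w m n. \<lbrakk>w \<in> vertices \<Lambda>; m \<noteq> n\<rbrakk> \<Longrightarrow>
      \<exists>\<kappa> \<in> with_range \<Lambda> {w} (Mor \<Lambda>). sup m n \<le> deg \<Lambda> \<kappa> \<and>
        segment \<Lambda> \<kappa> m (m + deg \<Lambda> \<kappa> - sup m n) \<noteq> segment \<Lambda> \<kappa> n (n + deg \<Lambda> \<kappa> - sup m n)"
  obtains x where "x \<in> boundary_paths_at \<Lambda> v" "aperiodic \<Lambda> x"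
proof -
  \<comment> \<open>\<open>R \<kappa> m n\<close>: the path \<open>\<kappa>\<close> tells \<open>m\<close> from \<open>n\<close>\<close>
  define R where "R \<kappa> m n \<longleftrightarrow> sup m n \<le> deg \<Lambda> \<kappa> \<and>
    segment \<Lambda> \<kappa> m (m + deg \<Lambda> \<kappa> - sup m n) \<noteq> segment \<Lambda> \<kappa> n (n + deg \<Lambda> \<kappa> - sup m n)" for \<kappa> m n
  define pr where "pr = (from_nat :: nat \<Rightarrow> ('k \<Rightarrow> nat) \<times> ('k \<Rightarrow> nat))"
  \<comment> \<open>at stage \<open>j\<close>, the path \<open>l\<close> is extended by a \<open>\<kappa>\<close> that tells apart the \<open>j\<close>-th pair; the degree
    grows by at least one in each coordinate so that the limit is infinite\<close>
  define Q where "Q j l l' \<longleftrightarrow> (\<exists>\<kappa> \<in> Mor \<Lambda>. src \<Lambda> l = rng \<Lambda> \<kappa> \<and> l \<cdot> \<kappa> \<preceq> l' \<and>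
    deg \<Lambda> l + 1 \<le> deg \<Lambda> l' \<and> (\<forall>m n. pr j = (m, n) \<longrightarrow> m \<noteq> n \<longrightarrow> R \<kappa> m n))" for j l l'
  have step: "\<exists>l'. (l' \<in> Mor \<Lambda> \<and> rng \<Lambda> l' = v) \<and> Q j l l'"
    if l: "l \<in> Mor \<Lambda> \<and> rng \<Lambda> l = v" for l j
  proof -
    obtain m n where mn: "pr j = (m, n)" by force
    have "\<exists>\<kappa> \<in> Mor \<Lambda>. rng \<Lambda> \<kappa> = src \<Lambda> l \<and> (m \<noteq> n \<longrightarrow> R \<kappa> m n)"
    proof (cases "m = n")
      case True
      then show ?thesis using l src_closed rng_src by blast
    next
      case False
      from sep[OF src_vertex this] l show ?thesis
        by (auto simp: with_range_def R_def)
    qed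
    then obtain \<kappa> where k: "\<kappa> \<in> Mor \<Lambda>" "rng \<Lambda> \<kappa> = src \<Lambda> l" "m \<noteq> n \<longrightarrow> R \<kappa> m n"
      by blast
    obtain \<rho> where r: "\<rho> \<in> Mor \<Lambda>" "rng \<Lambda> \<rho> = src \<Lambda> \<kappa>" "deg \<Lambda> \<rho> = 1"
      using no_sources_obtain[OF ns src_vertex[OF k(1)]] .
    have lk: "l \<cdot> \<kappa> \<in> Mor \<Lambda>" "src \<Lambda> (l \<cdot> \<kappa>) = rng \<Lambda> \<rho>" "rng \<Lambda> (l \<cdot> \<kappa>) = v"
      "deg \<Lambda> (l \<cdot> \<kappa>) = deg \<Lambda> l + deg \<Lambda> \<kappa>"
      using l k r by (simp_all add: cmp_closed src_cmp rng_cmp deg_cmp)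
    have "Q j l (l \<cdot> \<kappa> \<cdot> \<rho>)"
      unfolding Q_def using lk r k mn
      by (intro bexI[of _ \<kappa>] conjI) (auto simp: deg_cmp le_fun_def intro: initial_pathI)
    moreover have "l \<cdot> \<kappa> \<cdot> \<rho> \<in> Mor \<Lambda> \<and> rng \<Lambda> (l \<cdot> \<kappa> \<cdot> \<rho>) = v"
      using lk r by (simp add: cmp_closed rng_cmp)
    ultimately show ?thesis by blast
  qed
  have "\<exists>L. \<forall>j. (L j \<in> Mor \<Lambda> \<and> rng \<Lambda> (L j) = v) \<and> Q j (L j) (L (Suc j))"
    by (rule dependent_nat_choice) (use vertex_rng[OF v] step in blast)+
  then obtain L where L: "L j \<in> Mor \<Lambda>" "rng \<Lambda> (L j) = v" "Q j (L j) (L (Suc j))" for j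
    by blast
  have chain: "L j \<preceq> L (Suc j)" for j
  proof -
    obtain \<kappa> where "\<kappa> \<in> Mor \<Lambda>" "src \<Lambda> (L j) = rng \<Lambda> \<kappa>" "L j \<cdot> \<kappa> \<preceq> L (Suc j)"
      using L(3)[of j] unfolding Q_def by blast
    then show ?thesis using initial_pathI[OF L(1)] initial_path_trans by blast
  qed
  have grow: "j \<le> deg \<Lambda> (L j) i" for j i
  proof (induction j)
    case (Suc j)
    have "deg \<Lambda> (L j) + 1 \<le> deg \<Lambda> (L (Suc j))" using L(3)[of j] unfolding Q_def by blast
    then have "deg \<Lambda> (L j) i + 1 \<le> deg \<Lambda> (L (Suc j)) i" by (auto simp: le_fun_def dest: spec[of _ i])
    then show ?case using Suc by simp
  qed simp
  have unbdd: "\<exists>j. q \<le> deg \<Lambda> (L j)" for q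
  proof -
    have "q i \<le> sum q UNIV" for i by (rule member_le_sum) auto
    then have "q \<le> deg \<Lambda> (L (sum q UNIV))"
      using grow order_trans unfolding le_fun_def by blast
    then show ?thesis ..
  qed
  obtain x where x: "x \<in> path_space \<Lambda>" "pdeg x = (\<lambda>_. \<infinity>)" "\<And>j. pseg x 0 (deg \<Lambda> (L j)) = L j"
    using infinite_path_of_chain[OF chain unbdd] by blast
  have le: "enat \<circ> q \<le> pdeg x" for q by (simp add: x le_fun_def)
  have z: "0 \<le> q" for q :: "'k \<Rightarrow> nat" by (simp add: le_fun_def)
  have "prng x = v"
    using path_space_pseg(2)[OF x(1) z le, of "deg \<Lambda> (L 0)"] L(2)[of 0] x(3)[of 0]
    by (simp add: prng_def)
  then have "x \<in> boundary_paths_at \<Lambda> v"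
    using infinite_path_boundary x by (simp add: boundary_paths_at_def)
  moreover have "aperiodic \<Lambda> x"
    unfolding aperiodic_def
  proof (intro allI impI, rule ccontr)
    fix m n assume eq: "shift \<Lambda> m x = shift \<Lambda> n x" and "m \<noteq> n"
    have inf: "pdeg x - (enat \<circ> q) = (\<lambda>_. \<infinity>)" for q by (simp add: x fun_eq_iff)
    have per: "pseg x (m + p) (m + q) = pseg x (n + p) (n + q)" if "p \<le> q" for p q
    proof -
      have "(p, q) \<in> Mor (Omega (\<lambda>_. \<infinity>))" using that by (simp add: Omega_def le_fun_def)
      then show ?thesis
        using arg_cong[OF eq, of "\<lambda>y. snd y (p, q)"]
        unfolding shift_eq[OF x(1) le] inf by simp
    qed
    obtain j where j: "pr j = (m, n)" using surj_from_nat unfolding pr_def by (metis surjD)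
    obtain \<kappa> where k: "\<kappa> \<in> Mor \<Lambda>" "src \<Lambda> (L j) = rng \<Lambda> \<kappa>" "L j \<cdot> \<kappa> \<preceq> L (Suc j)" "R \<kappa> m n"
      using L(3)[of j] j \<open>m \<noteq> n\<close> unfolding Q_def by blast
    let ?p = "deg \<Lambda> (L j)"
    let ?u = "?p + deg \<Lambda> \<kappa>"
    have u: "?p \<le> ?u" "?u \<le> deg \<Lambda> (L (Suc j))"
      using initial_path_deg_le[OF k(3)] L(1) k by (auto simp: deg_cmp le_fun_def)
    have pu: "pseg x 0 ?u = L j \<cdot> pseg x ?p ?u"
      using pseg_cmp[OF x(1) z u(1) le] x(3) by simp
    have "pseg x 0 ?u = L j \<cdot> \<kappa>"
    proof (rule initial_path_unique)
      show "L j \<cdot> \<kappa> \<preceq> L (Suc j)" by fact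
      show "pseg x 0 ?u \<preceq> L (Suc j)"
        using pseg_cmp[OF x(1) z u(2) le] x(3)[of "Suc j"] path_space_pseg[OF x(1) z le, of ?u]
          path_space_pseg[OF x(1) u(2) le] initial_pathI by metis
      show "deg \<Lambda> (pseg x 0 ?u) = deg \<Lambda> (L j \<cdot> \<kappa>)"
        using path_space_pseg(4)[OF x(1) z le, of ?u] L(1) k by (simp add: deg_cmp)
    qed
    then have \<kappa>: "\<kappa> = pseg x ?p ?u"
      using pu cmp_left_cancel[of "L j" \<kappa> "pseg x ?p ?u"] L(1) k path_space_pseg[OF x(1) u(1) le]
        path_space_pseg[OF x(1) z le, of ?p] x(3)[of j] by simp
    let ?l = "deg \<Lambda> \<kappa> - sup m n"
    have N: "sup m n \<le> deg \<Lambda> \<kappa>" using k(4) by (simp add: R_def)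
    have read: "segment \<Lambda> \<kappa> c (c + deg \<Lambda> \<kappa> - sup m n) = pseg x (c + ?p) (c + (?p + ?l))"
      if c: "c \<le> sup m n" for c
    proof -
      have "c i + (deg \<Lambda> \<kappa> i - sup m n i) \<le> deg \<Lambda> \<kappa> i" for i
        using le_funD[OF c, of i] le_funD[OF N, of i] by simp
      then have "c + (?p + ?l) \<le> ?u" by (auto simp: le_fun_def add.left_commute)
      moreover have "?p \<le> c + ?p" "c + ?p \<le> c + (?p + ?l)" by (simp_all add: le_fun_def)
      ultimately have "segment \<Lambda> (pseg x ?p ?u) (c + ?p - ?p) (c + (?p + ?l) - ?p)
          = pseg x (c + ?p) (c + (?p + ?l))"
        by (intro segment_pseg[OF x(1)] le)
      moreover have "c + ?p - ?p = c" by simp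
      moreover have "c + (?p + ?l) - ?p = c + deg \<Lambda> \<kappa> - sup m n"
      proof
        fix i show "(c + (?p + ?l) - ?p) i = (c + deg \<Lambda> \<kappa> - sup m n) i"
          using le_funD[OF N, of i] by (simp del: sup_apply)
      qed
      ultimately show ?thesis using \<kappa> by simp
    qed
    have "?p \<le> ?p + ?l" by (simp add: le_fun_def)
    from per[OF this] have "segment \<Lambda> \<kappa> m (m + deg \<Lambda> \<kappa> - sup m n) = segment \<Lambda> \<kappa> n (n + deg \<Lambda> \<kappa> - sup m n)"
      using read[of m] read[of n] by simp
    then show False using k(4) by (simp add: R_def)
  qed
  ultimately show ?thesis using that by blast
qed

section \<open>Overlapping paths make boundary paths periodic\<close>

text \<open>
  Let \<open>\<tau>\<close> be an initial segment of \<open>x\<close> that has the full length of \<open>x\<close> in coordinate \<open>i\<close>. The set \<open>F\<close>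
  of all \<open>\<eta>\<close> with \<open>\<beta>\<tau>\<eta> \<in> MCE(\<alpha>\<tau>, \<beta>\<tau>)\<close> is finite by finite alignment, and exhaustive since \<open>\<alpha>\<tau>\<rho>\<close>
  and \<open>\<beta>\<tau>\<rho>\<close> have common extensions for all \<open>\<rho>\<close>. So \<open>x\<close> continues after \<open>\<tau>\<close> with some \<open>\<eta> \<in> F\<close>;
  but \<open>d(\<eta>)\<^sub>i = d(\<alpha>)\<^sub>i - d(\<beta>)\<^sub>i\<close> if \<open>d(\<alpha>)\<^sub>i > d(\<beta>)\<^sub>i\<close>, and \<open>x\<close> has no room for this.
\<close>
lemma overlap_deg_le_on_finite_coordinate:
  assumes fa: "finitely_aligned \<Lambda>"
    and \<alpha>\<beta>: "\<alpha> \<in> Mor \<Lambda>" "\<beta> \<in> Mor \<Lambda>" "src \<Lambda> \<alpha> = src \<Lambda> \<beta>"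
    and overlap: "\<And>\<tau>. \<lbrakk>\<tau> \<in> Mor \<Lambda>; rng \<Lambda> \<tau> = src \<Lambda> \<alpha>\<rbrakk> \<Longrightarrow> MCE \<Lambda> (\<alpha> \<cdot> \<tau>) (\<beta> \<cdot> \<tau>) \<noteq> {}"
    and x: "x \<in> boundary_paths_at \<Lambda> (src \<Lambda> \<alpha>)" and fin: "pdeg x i \<noteq> \<infinity>"
  shows "deg \<Lambda> \<alpha> i \<le> deg \<Lambda> \<beta> i"
proof (rule ccontr)
  assume "\<not> ?thesis"
  then have gt: "deg \<Lambda> \<beta> i < deg \<Lambda> \<alpha> i" by simp
  have xp: "x \<in> path_space \<Lambda>" and x0: "pseg x 0 0 = src \<Lambda> \<alpha>"
    using x by (auto simp: boundary_paths_at_def boundary_paths_def prng_def)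
  obtain N where N: "pdeg x i = enat N" using fin by auto
  define p where "p = (\<lambda>j. if j = i then N else 0)"
  have p: "0 \<le> p" "enat \<circ> p \<le> pdeg x"
    using N by (auto simp: p_def le_fun_def zero_enat_def[symmetric])
  define \<tau> where "\<tau> = pseg x 0 p"
  have \<tau>: "\<tau> \<in> Mor \<Lambda>" "rng \<Lambda> \<tau> = src \<Lambda> \<alpha>" "src \<Lambda> \<tau> = pseg x p p"
    using path_space_pseg[OF xp p] x0 by (simp_all add: \<tau>_def)
  have \<alpha>\<tau>: "\<alpha> \<cdot> \<tau> \<in> Mor \<Lambda>" "src \<Lambda> (\<alpha> \<cdot> \<tau>) = src \<Lambda> \<tau>" and \<beta>\<tau>: "\<beta> \<cdot> \<tau> \<in> Mor \<Lambda>" "src \<Lambda> (\<beta> \<cdot> \<tau>) = src \<Lambda> \<tau>"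
    using \<tau> \<alpha>\<beta> by (simp_all add: cmp_closed src_cmp)
  define F where "F = {\<eta> \<in> Mor \<Lambda>. rng \<Lambda> \<eta> = src \<Lambda> \<tau> \<and> \<beta> \<cdot> \<tau> \<cdot> \<eta> \<in> MCE \<Lambda> (\<alpha> \<cdot> \<tau>) (\<beta> \<cdot> \<tau>)}"
  have "inj_on (\<lambda>\<eta>. \<beta> \<cdot> \<tau> \<cdot> \<eta>) F"
    unfolding inj_on_def F_def using cmp_left_cancel[of "\<beta> \<cdot> \<tau>"] \<beta>\<tau> by auto
  moreover have "finite ((\<lambda>\<eta>. \<beta> \<cdot> \<tau> \<cdot> \<eta>) ` F)"
    using fa \<alpha>\<tau> \<beta>\<tau> unfolding finitely_aligned_def
    by (rule_tac finite_subset[of _ "MCE \<Lambda> (\<alpha> \<cdot> \<tau>) (\<beta> \<cdot> \<tau>)"]) (auto simp: F_def)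
  ultimately have "finite F" using finite_imageD by blast
  \<comment> \<open>a common extension of \<open>\<alpha>\<tau>\<rho>\<close> and \<open>\<beta>\<tau>\<rho>\<close> extends some minimal \<open>\<beta>\<tau>\<eta>\<close>; cancelling \<open>\<beta>\<tau>\<close> leaves a
    common extension of \<open>\<rho>\<close> and \<open>\<eta>\<close>\<close>
  have exh: "\<exists>\<eta> \<in> F. MCE \<Lambda> \<rho> \<eta> \<noteq> {}" if r: "\<rho> \<in> Mor \<Lambda>" "rng \<Lambda> \<rho> = src \<Lambda> \<tau>" for \<rho>
  proof -
    have \<tau>\<rho>: "\<tau> \<cdot> \<rho> \<in> Mor \<Lambda>" "rng \<Lambda> (\<tau> \<cdot> \<rho>) = src \<Lambda> \<alpha>"
      using \<tau> r by (simp_all add: cmp_closed rng_cmp)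
    obtain \<kappa> where "\<kappa> \<in> MCE \<Lambda> (\<alpha> \<cdot> (\<tau> \<cdot> \<rho>)) (\<beta> \<cdot> (\<tau> \<cdot> \<rho>))"
      using overlap[OF \<tau>\<rho>] by blast
    then have "\<alpha> \<cdot> (\<tau> \<cdot> \<rho>) \<preceq> \<kappa>" "\<beta> \<cdot> (\<tau> \<cdot> \<rho>) \<preceq> \<kappa>"
      using \<tau>\<rho> \<alpha>\<beta> by (simp_all add: MCE_iff_initial_path cmp_closed)
    moreover have "\<alpha> \<cdot> (\<tau> \<cdot> \<rho>) = \<alpha> \<cdot> \<tau> \<cdot> \<rho>" "\<beta> \<cdot> (\<tau> \<cdot> \<rho>) = \<beta> \<cdot> \<tau> \<cdot> \<rho>"
      using \<tau> r \<alpha>\<beta> by (simp_all add: cmp_assoc)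
    ultimately have k: "\<alpha> \<cdot> \<tau> \<cdot> \<rho> \<preceq> \<kappa>" "\<beta> \<cdot> \<tau> \<cdot> \<rho> \<preceq> \<kappa>" by simp_all
    have k': "\<alpha> \<cdot> \<tau> \<preceq> \<kappa>" "\<beta> \<cdot> \<tau> \<preceq> \<kappa>"
      using k initial_pathI[of _ \<rho>] initial_path_trans \<alpha>\<tau> \<beta>\<tau> r by metis+
    obtain \<xi> where \<xi>: "\<xi> \<in> MCE \<Lambda> (\<alpha> \<cdot> \<tau>) (\<beta> \<cdot> \<tau>)" "\<xi> \<preceq> \<kappa>"
      using common_extension_MCE[OF k'] .
    then have "\<beta> \<cdot> \<tau> \<preceq> \<xi>" using \<alpha>\<tau> \<beta>\<tau> by (simp add: MCE_iff_initial_path)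
    then obtain \<eta> where \<eta>: "\<eta> \<in> Mor \<Lambda>" "src \<Lambda> (\<beta> \<cdot> \<tau>) = rng \<Lambda> \<eta>" "\<xi> = \<beta> \<cdot> \<tau> \<cdot> \<eta>"
      by (rule initial_pathE)
    obtain \<zeta> where \<zeta>: "\<zeta> \<in> Mor \<Lambda>" "src \<Lambda> (\<beta> \<cdot> \<tau>) = rng \<Lambda> \<zeta>" "\<kappa> = \<beta> \<cdot> \<tau> \<cdot> \<zeta>"
      using k'(2) by (rule initial_pathE)
    have "\<rho> \<preceq> \<zeta>" "\<eta> \<preceq> \<zeta>"
      using k(2) \<xi>(2) \<eta> \<zeta> r \<beta>\<tau> initial_path_left_cancel[of "\<beta> \<cdot> \<tau>"] by simp_all
    then have "MCE \<Lambda> \<rho> \<eta> \<noteq> {}" using common_extension_MCE by blast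
    moreover have "\<eta> \<in> F" using \<eta> \<xi> \<beta>\<tau> by (simp add: F_def)
    ultimately show ?thesis by blast
  qed
  have "F \<noteq> {}" using exh[of "src \<Lambda> \<tau>"] \<tau> src_closed rng_src by blast
  then have "rng \<Lambda> ` F = {pseg x p p}" using \<tau> by (auto simp: F_def)
  then have "compact_exhaustive \<Lambda> (pseg x p p) F"
    unfolding compact_exhaustive_def with_range_def using \<open>finite F\<close> exh \<tau> by (auto simp: F_def)
  then obtain \<eta> where \<eta>: "\<eta> \<in> F" "enat \<circ> (p + deg \<Lambda> \<eta>) \<le> pdeg x"
    using x p by (auto simp: boundary_paths_at_def boundary_paths_def)
  have "deg \<Lambda> (\<beta> \<cdot> \<tau> \<cdot> \<eta>) = sup (deg \<Lambda> (\<alpha> \<cdot> \<tau>)) (deg \<Lambda> (\<beta> \<cdot> \<tau>))"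
    using \<eta> by (auto simp: F_def MCE_def)
  then have "deg \<Lambda> \<beta> + deg \<Lambda> \<tau> + deg \<Lambda> \<eta> = sup (deg \<Lambda> \<alpha> + deg \<Lambda> \<tau>) (deg \<Lambda> \<beta> + deg \<Lambda> \<tau>)"
    using \<eta> \<tau> \<alpha>\<beta> \<beta>\<tau> by (simp add: F_def deg_cmp)
  from fun_cong[OF this, of i] have "deg \<Lambda> \<eta> i > 0" using gt by (simp add: sup_max)
  moreover have "p i + deg \<Lambda> \<eta> i \<le> N"
    using le_funD[OF \<eta>(2), of i] N by simp
  ultimately show False by (simp add: p_def)
qed

text \<open>
  The common extensions \<open>\<kappa>\<close> of \<open>\<alpha>x(0, q)\<close> and \<open>\<beta>x(0, q)\<close> take the place of the composite infinite
  path \<open>\<alpha>x = \<beta>x\<close>: the segment of \<open>\<kappa>\<close> of degree \<open>p\<close> after \<open>d(\<alpha>) \<or> d(\<beta>)\<close> is \<open>x(m, m + p)\<close> when read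
  through \<open>\<alpha>\<close>, and \<open>x(n, n + p)\<close> when read through \<open>\<beta>\<close>. Both shifts are defined, and have
  the same degree, because \<open>m\<close> and \<open>n\<close> vanish wherever \<open>x\<close> is finite.
\<close>
lemma overlap_imp_periodic:
  assumes fa: "finitely_aligned \<Lambda>"
    and \<alpha>\<beta>: "\<alpha> \<in> Mor \<Lambda>" "\<beta> \<in> Mor \<Lambda>" "\<alpha> \<noteq> \<beta>" "src \<Lambda> \<alpha> = src \<Lambda> \<beta>"
    and overlap: "\<And>\<tau>. \<lbrakk>\<tau> \<in> Mor \<Lambda>; rng \<Lambda> \<tau> = src \<Lambda> \<alpha>\<rbrakk> \<Longrightarrow> MCE \<Lambda> (\<alpha> \<cdot> \<tau>) (\<beta> \<cdot> \<tau>) \<noteq> {}"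
    and x: "x \<in> boundary_paths_at \<Lambda> (src \<Lambda> \<alpha>)"
  shows "\<not> aperiodic \<Lambda> x"
proof -
  have xp: "x \<in> path_space \<Lambda>" and x0: "pseg x 0 0 = src \<Lambda> \<alpha>"
    using x by (auto simp: boundary_paths_at_def boundary_paths_def prng_def)
  have z: "0 \<le> q" for q :: "'k \<Rightarrow> nat" by (simp add: le_fun_def)
  let ?N = "sup (deg \<Lambda> \<alpha>) (deg \<Lambda> \<beta>)"
  define m where "m = ?N - deg \<Lambda> \<alpha>"
  define n where "n = ?N - deg \<Lambda> \<beta>"
  have am: "deg \<Lambda> \<alpha> + m = ?N" and bn: "deg \<Lambda> \<beta> + n = ?N"
    by (auto simp: m_def n_def fun_eq_iff sup_max)
  have "deg \<Lambda> \<alpha> \<noteq> deg \<Lambda> \<beta>"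
  proof
    assume d: "deg \<Lambda> \<alpha> = deg \<Lambda> \<beta>"
    have "MCE \<Lambda> (\<alpha> \<cdot> src \<Lambda> \<alpha>) (\<beta> \<cdot> src \<Lambda> \<alpha>) \<noteq> {}"
      using \<alpha>\<beta>(1) by (intro overlap src_closed rng_src)
    moreover have "\<alpha> \<cdot> src \<Lambda> \<alpha> = \<alpha>" "\<beta> \<cdot> src \<Lambda> \<alpha> = \<beta>"
      using src_id \<alpha>\<beta> by metis+
    ultimately obtain \<kappa> where "\<kappa> \<in> MCE \<Lambda> \<alpha> \<beta>"
      by auto
    then have "\<alpha> = \<beta>"
      using d \<alpha>\<beta> initial_path_unique MCE_iff_initial_path by blast
    then show False using \<alpha>\<beta> by simp
  qed
  then have "m \<noteq> n" using am bn by (metis add_right_cancel)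
  have fin: "deg \<Lambda> \<alpha> i = deg \<Lambda> \<beta> i" if "pdeg x i \<noteq> \<infinity>" for i
    using overlap_deg_le_on_finite_coordinate[OF fa \<alpha>\<beta>(1,2,4) overlap x that]
      overlap_deg_le_on_finite_coordinate[OF fa \<alpha>\<beta>(2,1) \<alpha>\<beta>(4)[symmetric] _ _ that] overlap x \<alpha>\<beta>(4)
    by (simp add: MCE_commute order_antisym)
  have mi: "m i = 0 \<and> n i = 0 \<or> pdeg x i = \<infinity>" for i
    using fin[of i] by (auto simp: m_def n_def)
  have deg_mn: "pdeg x - (enat \<circ> m) = pdeg x - (enat \<circ> n)"
  proof
    fix i show "(pdeg x - (enat \<circ> m)) i = (pdeg x - (enat \<circ> n)) i"
      using mi[of i] by auto
  qed
  have le: "enat \<circ> m \<le> pdeg x" "enat \<circ> n \<le> pdeg x"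
  proof -
    have "enat (m i) \<le> pdeg x i \<and> enat (n i) \<le> pdeg x i" for i
      using mi[of i] by (auto simp: zero_enat_def[symmetric])
    then show "enat \<circ> m \<le> pdeg x" "enat \<circ> n \<le> pdeg x" by (auto simp: le_fun_def)
  qed
  \<comment> \<open>\<open>q\<close> is just large enough for \<open>x(0, q)\<close> to contain both segments\<close>
  have seg: "pseg x m (m + p) = pseg x n (n + p)" if p: "enat \<circ> p \<le> pdeg x - (enat \<circ> m)" for p
  proof -
    have mp: "enat \<circ> (m + p) \<le> pdeg x" "enat \<circ> (n + p) \<le> pdeg x"
      using add_le_enat_diff[OF le(1) p] add_le_enat_diff[OF le(2)] p deg_mn by simp_all
    define q where "q = sup (m + p) (n + p)"
    have q: "enat \<circ> q \<le> pdeg x"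
      using mp by (auto simp: q_def le_fun_def sup_max max_def)
    define \<tau> where "\<tau> = pseg x 0 q"
    have \<tau>: "\<tau> \<in> Mor \<Lambda>" "rng \<Lambda> \<tau> = src \<Lambda> \<alpha>"
      using path_space_pseg[OF xp z q] x0 by (simp_all add: \<tau>_def)
    obtain \<kappa> where \<kappa>: "\<kappa> \<in> MCE \<Lambda> (\<alpha> \<cdot> \<tau>) (\<beta> \<cdot> \<tau>)" using overlap[OF \<tau>] by blast
    have read: "segment \<Lambda> \<kappa> ?N (?N + p) = pseg x c (c + p)"
      if g: "\<gamma> \<in> Mor \<Lambda>" "src \<Lambda> \<gamma> = src \<Lambda> \<alpha>" "\<gamma> \<cdot> \<tau> \<preceq> \<kappa>" "deg \<Lambda> \<gamma> + c = ?N" "c + p \<le> q" for \<gamma> c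
    proof -
      have c: "c \<le> c + p" "c \<le> q" using g(5) by (auto simp: le_fun_def intro: order_trans[OF le_add1])
      have cp: "enat \<circ> (c + p) \<le> pdeg x" "enat \<circ> c \<le> pdeg x"
        using q g(5) c enat_comp_le_trans by blast+
      obtain \<rho> where r: "\<rho> \<in> Mor \<Lambda>" "src \<Lambda> (\<gamma> \<cdot> \<tau>) = rng \<Lambda> \<rho>" "\<kappa> = \<gamma> \<cdot> \<tau> \<cdot> \<rho>"
        using g(3) by (rule initial_pathE)
      let ?a = "pseg x 0 c" and ?b = "pseg x c (c + p)" and ?e = "pseg x (c + p) q"
      note a = path_space_pseg[OF xp z cp(2)] and b = path_space_pseg[OF xp c(1) cp(1)]
        and e = path_space_pseg[OF xp g(5) q]
      have "\<tau> = ?a \<cdot> (?b \<cdot> ?e)"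
        using pseg_cmp[OF xp z c(2) q] pseg_cmp[OF xp c(1) g(5) q] by (simp add: \<tau>_def)
      then have "\<kappa> = (\<gamma> \<cdot> ?a) \<cdot> (?b \<cdot> (?e \<cdot> \<rho>))"
        using r g a b e x0 \<tau>
        by (simp add: cmp_assoc cmp_closed rng_cmp src_cmp)
      moreover have "src \<Lambda> ?e = rng \<Lambda> \<rho>"
        using r g \<tau> e path_space_pseg(3)[OF xp z q] by (simp add: src_cmp \<tau>_def)
      moreover have "deg \<Lambda> (\<gamma> \<cdot> ?a) = ?N" "deg \<Lambda> ?b = p"
        using g a b x0 by (simp_all add: deg_cmp)
      ultimately show ?thesis
        using segment_cmp[of "\<gamma> \<cdot> ?a" ?b "?e \<cdot> \<rho>" ?N "?N + p"] g a b e r x0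
        by (simp add: cmp_closed rng_cmp src_cmp)
    qed
    have "\<alpha> \<cdot> \<tau> \<preceq> \<kappa>" "\<beta> \<cdot> \<tau> \<preceq> \<kappa>"
      using \<kappa> \<tau> \<alpha>\<beta> by (simp_all add: MCE_iff_initial_path cmp_closed)
    moreover have "m + p \<le> q" "n + p \<le> q" by (simp_all add: q_def)
    ultimately show ?thesis
      using read[of \<alpha> m] read[of \<beta> n] \<alpha>\<beta> am bn by simp
  qed
  have "shift \<Lambda> m x = shift \<Lambda> n x"
  proof -
    have "(y \<in> path_space \<Lambda> \<and> pdeg y = pdeg x - (enat \<circ> m) \<and>
        (\<forall>p. enat \<circ> p \<le> pdeg x - (enat \<circ> m) \<longrightarrow> pseg y 0 p = pseg x m (m + p))) \<longleftrightarrow>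
      (y \<in> path_space \<Lambda> \<and> pdeg y = pdeg x - (enat \<circ> n) \<and>
        (\<forall>p. enat \<circ> p \<le> pdeg x - (enat \<circ> n) \<longrightarrow> pseg y 0 p = pseg x n (n + p)))" for y
      using seg deg_mn by auto
    then show ?thesis unfolding shift_def by presburger
  qed
  then show ?thesis using \<open>m \<noteq> n\<close> le unfolding aperiodic_def by blast
qed

end

section \<open>The equivalence\<close>

theorem corollary3p2:
  fixes \<Lambda> :: "('a, 'k::finite) graded_category"
  assumes "discrete_k_graph \<Lambda>"
    and "finitely_aligned \<Lambda>"
    and "no_sources \<Lambda>"
  shows "((\<forall>v \<in> vertices \<Lambda>. \<exists>x \<in> boundary_paths_at \<Lambda> v. aperiodic \<Lambda> x) \<longleftrightarrow>
          (\<forall>v \<in> vertices \<Lambda>. \<forall>m n. m \<noteq> n \<longrightarrow>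
             (\<exists>\<kappa> \<in> with_range \<Lambda> {v} (Mor \<Lambda>). sup m n \<le> deg \<Lambda> \<kappa> \<and>
                segment \<Lambda> \<kappa> m (m + deg \<Lambda> \<kappa> - sup m n) \<noteq>
                segment \<Lambda> \<kappa> n (n + deg \<Lambda> \<kappa> - sup m n)))) \<and>
         ((\<forall>v \<in> vertices \<Lambda>. \<exists>x \<in> boundary_paths_at \<Lambda> v. aperiodic \<Lambda> x) \<longleftrightarrow>
          (\<forall>\<alpha> \<in> Mor \<Lambda>. \<forall>\<beta> \<in> Mor \<Lambda>. \<alpha> \<noteq> \<beta> \<and> src \<Lambda> \<alpha> = src \<Lambda> \<beta> \<longrightarrow>
             (\<exists>\<tau> \<in> with_range \<Lambda> {src \<Lambda> \<alpha>} (Mor \<Lambda>).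
                MCE \<Lambda> (\<alpha> \<cdot>\<^bsub>\<Lambda>\<^esub> \<tau>) (\<beta> \<cdot>\<^bsub>\<Lambda>\<^esub> \<tau>) = {})))"
proof -
  interpret discrete_k_graph \<Lambda> by fact
  let ?I = "\<forall>v \<in> vertices \<Lambda>. \<exists>x \<in> boundary_paths_at \<Lambda> v. aperiodic \<Lambda> x"
  let ?II = "\<forall>v \<in> vertices \<Lambda>. \<forall>m n. m \<noteq> n \<longrightarrow>
             (\<exists>\<kappa> \<in> with_range \<Lambda> {v} (Mor \<Lambda>). sup m n \<le> deg \<Lambda> \<kappa> \<and>
                segment \<Lambda> \<kappa> m (m + deg \<Lambda> \<kappa> - sup m n) \<noteq>
                segment \<Lambda> \<kappa> n (n + deg \<Lambda> \<kappa> - sup m n))"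
  let ?III = "\<forall>\<alpha> \<in> Mor \<Lambda>. \<forall>\<beta> \<in> Mor \<Lambda>. \<alpha> \<noteq> \<beta> \<and> src \<Lambda> \<alpha> = src \<Lambda> \<beta> \<longrightarrow>
             (\<exists>\<tau> \<in> with_range \<Lambda> {src \<Lambda> \<alpha>} (Mor \<Lambda>).
                MCE \<Lambda> (\<alpha> \<cdot>\<^bsub>\<Lambda>\<^esub> \<tau>) (\<beta> \<cdot>\<^bsub>\<Lambda>\<^esub> \<tau>) = {})"
  have "?III" if I: "?I"
  proof (intro ballI impI, rule ccontr)
    fix \<alpha> \<beta> assume ab: "\<alpha> \<in> Mor \<Lambda>" "\<beta> \<in> Mor \<Lambda>" "\<alpha> \<noteq> \<beta> \<and> src \<Lambda> \<alpha> = src \<Lambda> \<beta>"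
      and "\<not> (\<exists>\<tau> \<in> with_range \<Lambda> {src \<Lambda> \<alpha>} (Mor \<Lambda>). MCE \<Lambda> (\<alpha> \<cdot>\<^bsub>\<Lambda>\<^esub> \<tau>) (\<beta> \<cdot>\<^bsub>\<Lambda>\<^esub> \<tau>) = {})"
    then have "MCE \<Lambda> (\<alpha> \<cdot>\<^bsub>\<Lambda>\<^esub> \<tau>) (\<beta> \<cdot>\<^bsub>\<Lambda>\<^esub> \<tau>) \<noteq> {}"
      if "\<tau> \<in> Mor \<Lambda>" "rng \<Lambda> \<tau> = src \<Lambda> \<alpha>" for \<tau>
      using that by (auto simp: with_range_def)
    then show False
      using overlap_imp_periodic[of \<alpha> \<beta>] I ab assms(2) src_vertex[of \<alpha>] by blast
  qed
  moreover have "?II" if III: "?III"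
  proof (intro ballI allI impI, rule ccontr)
    fix v m n assume v: "v \<in> vertices \<Lambda>" "m \<noteq> n"
      and neg: "\<not> (\<exists>\<kappa> \<in> with_range \<Lambda> {v} (Mor \<Lambda>). sup m n \<le> deg \<Lambda> \<kappa> \<and>
        segment \<Lambda> \<kappa> m (m + deg \<Lambda> \<kappa> - sup m n) \<noteq> segment \<Lambda> \<kappa> n (n + deg \<Lambda> \<kappa> - sup m n))"
    obtain \<alpha> \<beta> where "\<alpha> \<in> Mor \<Lambda>" "\<beta> \<in> Mor \<Lambda>" "\<alpha> \<noteq> \<beta>" "src \<Lambda> \<alpha> = src \<Lambda> \<beta>"
      "\<And>\<tau>. \<lbrakk>\<tau> \<in> Mor \<Lambda>; rng \<Lambda> \<tau> = src \<Lambda> \<alpha>\<rbrakk> \<Longrightarrow> MCE \<Lambda> (\<alpha> \<cdot>\<^bsub>\<Lambda>\<^esub> \<tau>) (\<beta> \<cdot>\<^bsub>\<Lambda>\<^esub> \<tau>) \<noteq> {}"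
      using neg by (rule_tac no_aperiodicity_imp_overlap[OF assms(3) v]) (auto simp: with_range_def)
    then show False using III by (fastforce simp: with_range_def)
  qed
  moreover have "?I" if II: "?II"
  proof
    fix v assume v: "v \<in> vertices \<Lambda>"
    show "\<exists>x \<in> boundary_paths_at \<Lambda> v. aperiodic \<Lambda> x"
      using aperiodicity_imp_aperiodic_path[OF assms(3) v II[rule_format]] by metis
  qed
  ultimately show ?thesis by blast
qed

end
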